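(* Let $n$ be a positive integer and let $d$ be a (positive) multiple of $n$. Let $\Lambda_n=\begin{bmatrix} k_n & k_n\oplus{}^{\sigma_n}k_n\\ 0 & k_n\end{bmatrix}$ and let $\mathcal{Q}_n$ be the $n$-crown quiver. Then $k_d\otimes_k\Lambda_n$ and the path algebra $k_d\mathcal{Q}_n$ are isomorphic as $k_d$-algebras.
   Context: $k=\mathbb{C}(\!(\varepsilon)\!)$ is the field of formal complex Laurent series and $k_n=\mathbb{C}(\!(\varepsilon^{1/n})\!)$ for $n\geq 1$, a cyclic Galois extension of $k$ of degree $n$. The automorphism $\sigma_n$ of $k_n$ over $k$ is given by $\sigma_n(\varepsilon^{j/n})=\zeta_n^j\varepsilon^{j/n}$ with $\zeta_n=e^{2\pi i/n}$. For a $k_n$-$k_n$-bimodule $X$, ${}^{\sigma_n}X$ denotes the bimodule with the same underlying group and right action, and with left action $y*x=\sigma_n(y)x$. $\Lambda_n$ is the upper triangular matrix $k$-algebra with diagonal entries in $k_n$ and upper right entries in the $k_n$-$k_n$-bimodule $k_n\oplus{}^{\sigma_n}k_n$. The $n$-crown quiver $\mathcal{Q}_n$ has vertices $1,\dots,n$ (sources) and $1',\dots,n'$ (sinks) and $2n$ arrows $\alpha_i:i\to i'$ and $\alpha_{i'}:i-1\to i'$ for $1\le i\le n$, indices taken modulo $n$ (so $\alpha_{1'}:n\to 1'$). For $n=1$ it is the 2-Kronecker quiver. *)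

theory Defs
  imports
    "HOL-Computational_Algebra.Formal_Laurent_Series"
    "HOL-Library.Poly_Mapping"
    "HOL-Algebra.Module"
    "HOL-Algebra.QuotRing"
    "HOL-Algebra.Generated_Groups"
    "HOL-Algebra.Algebraic_Closure_Type"
    "Graph_Theory.Arc_Walk"
    "HOL-Analysis.Complex_Transcendental"
begin

section \<open>Isomorphism of associative algebras\<close>

text \<open>
  An \<open>R\<close>-algebra is presented by the record \<^type>\<open>module\<close>, which carries a ring structure and
  a scalar multiplication. The library locale \<^locale>\<open>algebra\<close> only covers commutative
  algebras; the algebras below are not commutative.
\<close>

definition algebra_iso ::
  "('r, 'x) ring_scheme \<Rightarrow> ('r, 'a, 'y) module_scheme \<Rightarrow> ('r, 'b, 'z) module_scheme \<Rightarrow> ('a \<Rightarrow> 'b) set"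
  where "algebra_iso R A B =
    {h \<in> ring_iso A B. \<forall>c \<in> carrier R. \<forall>x \<in> carrier A. h (c \<odot>\<^bsub>A\<^esub> x) = c \<odot>\<^bsub>B\<^esub> h x}"

definition algebra_isomorphic ::
  "('r, 'x) ring_scheme \<Rightarrow> ('r, 'a, 'y) module_scheme \<Rightarrow> ('r, 'b, 'z) module_scheme \<Rightarrow> bool"
  where "algebra_isomorphic R A B \<longleftrightarrow> algebra_iso R A B \<noteq> {}"


section \<open>Tensor products of algebras\<close>

text \<open>
  For \<open>R\<close>-algebras \<open>A\<close> and \<open>B\<close>, the tensor product \<open>A \<otimes>\<^sub>R B\<close> is the free abelian group on
  \<open>A \<times> B\<close> modulo the subgroup generated by the usual relations, where a generator \<open>(a, b)\<close>
  represents \<open>a \<otimes> b\<close>. The free abelian group carries the ring structure determined by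
  \<open>(a, b) (a', b') = (a a', b b')\<close>; the subgroup of relations is an ideal for it, so the
  tensor product algebra is a quotient ring.
\<close>

definition free_tensor_ring ::
  "('a, 'y) ring_scheme \<Rightarrow> ('b, 'z) ring_scheme \<Rightarrow> ('a \<times> 'b \<Rightarrow>\<^sub>0 int) ring"
  where "free_tensor_ring A B =
    \<lparr> carrier = {f. Poly_Mapping.keys f \<subseteq> carrier A \<times> carrier B},
      monoid.mult = (\<lambda>f g. frag_extend (\<lambda>(a, b). frag_extend (\<lambda>(a', b').
                 frag_of (a \<otimes>\<^bsub>A\<^esub> a', b \<otimes>\<^bsub>B\<^esub> b')) g) f),
      one = frag_of (\<one>\<^bsub>A\<^esub>, \<one>\<^bsub>B\<^esub>),
      zero = 0,
      ring.add = (+) \<rparr>"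

definition tensor_relations ::
  "('r, 'x) ring_scheme \<Rightarrow> ('r, 'a, 'y) module_scheme \<Rightarrow> ('r, 'b, 'z) module_scheme
    \<Rightarrow> ('a \<times> 'b \<Rightarrow>\<^sub>0 int) set"
  where "tensor_relations R A B =
    {frag_of (a \<oplus>\<^bsub>A\<^esub> a', b) - frag_of (a, b) - frag_of (a', b) | a a' b.
       a \<in> carrier A \<and> a' \<in> carrier A \<and> b \<in> carrier B} \<union>
    {frag_of (a, b \<oplus>\<^bsub>B\<^esub> b') - frag_of (a, b) - frag_of (a, b') | a b b'.
       a \<in> carrier A \<and> b \<in> carrier B \<and> b' \<in> carrier B} \<union>
    {frag_of (c \<odot>\<^bsub>A\<^esub> a, b) - frag_of (a, c \<odot>\<^bsub>B\<^esub> b) | c a b.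
       c \<in> carrier R \<and> a \<in> carrier A \<and> b \<in> carrier B}"

definition tensor_ideal ::
  "('r, 'x) ring_scheme \<Rightarrow> ('r, 'a, 'y) module_scheme \<Rightarrow> ('r, 'b, 'z) module_scheme
    \<Rightarrow> ('a \<times> 'b \<Rightarrow>\<^sub>0 int) set"
  where "tensor_ideal R A B = generate (add_monoid (free_tensor_ring A B)) (tensor_relations R A B)"

definition tensor_ring ::
  "('r, 'x) ring_scheme \<Rightarrow> ('r, 'a, 'y) module_scheme \<Rightarrow> ('r, 'b, 'z) module_scheme
    \<Rightarrow> ('a \<times> 'b \<Rightarrow>\<^sub>0 int) set ring"
  where "tensor_ring R A B = free_tensor_ring A B Quot tensor_ideal R A B"

definition pure_tensor ::
  "('r, 'x) ring_scheme \<Rightarrow> ('r, 'a, 'y) module_scheme \<Rightarrow> ('r, 'b, 'z) module_scheme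
    \<Rightarrow> 'a \<Rightarrow> 'b \<Rightarrow> ('a \<times> 'b \<Rightarrow>\<^sub>0 int) set"
  where "pure_tensor R A B a b = tensor_ideal R A B +>\<^bsub>free_tensor_ring A B\<^esub> frag_of (a, b)"

text \<open>
  For a commutative \<open>R\<close>-algebra \<open>S\<close>, the ring \<open>S \<otimes>\<^sub>R A\<close> is an \<open>S\<close>-algebra through the ring
  homomorphism sending \<open>s\<close> to \<open>s \<otimes> 1\<close>.
\<close>

definition base_change ::
  "('r, 'x) ring_scheme \<Rightarrow> ('r, 's, 'y) module_scheme \<Rightarrow> ('r, 'a, 'z) module_scheme
    \<Rightarrow> ('s, ('s \<times> 'a \<Rightarrow>\<^sub>0 int) set) module"
  where "base_change R S A = ring.extend (tensor_ring R S A)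
    (module.fields (\<lambda>s z. pure_tensor R S A s \<one>\<^bsub>A\<^esub> \<otimes>\<^bsub>tensor_ring R S A\<^esub> z))"


section \<open>Bimodules and triangular matrix algebras\<close>

record ('l, 'm, 'r) bimodule = "'m partial_object" +
  bzero :: 'm
  badd :: "'m \<Rightarrow> 'm \<Rightarrow> 'm"
  lact :: "'l \<Rightarrow> 'm \<Rightarrow> 'm"
  ract :: "'m \<Rightarrow> 'r \<Rightarrow> 'm"

definition regular_bimodule :: "('a, 'x) ring_scheme \<Rightarrow> ('a, 'a, 'a) bimodule"
  where "regular_bimodule A =
    \<lparr> carrier = carrier A, bzero = \<zero>\<^bsub>A\<^esub>, badd = ring.add A,
      lact = monoid.mult A, ract = monoid.mult A \<rparr>"

definition left_twist :: "('l \<Rightarrow> 'l) \<Rightarrow> ('l, 'm, 'r) bimodule \<Rightarrow> ('l, 'm, 'r) bimodule"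
  where "left_twist \<phi> L = L \<lparr> lact := (\<lambda>y x. lact L (\<phi> y) x) \<rparr>"

definition bimodule_sum ::
  "('l, 'm, 'r) bimodule \<Rightarrow> ('l, 'm', 'r) bimodule \<Rightarrow> ('l, 'm \<times> 'm', 'r) bimodule"
  where "bimodule_sum L N =
    \<lparr> carrier = carrier L \<times> carrier N,
      bzero = (bzero L, bzero N),
      badd = (\<lambda>(x, y) (x', y'). (badd L x x', badd N y y')),
      lact = (\<lambda>a (x, y). (lact L a x, lact N a y)),
      ract = (\<lambda>(x, y) a. (ract L x a, ract N y a)) \<rparr>"

text \<open>
  The triple \<open>(a, m, b)\<close> stands for the matrix with diagonal entries \<open>a\<close>, \<open>b\<close> and upper right
  entry \<open>m\<close>. Scalars act entrywise, where \<open>c\<close> acts on \<open>M\<close> as the element \<open>c 1\<close> of \<open>A\<close>;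
  this makes sense as an algebra when the ground ring acts centrally on \<open>M\<close>, i.e. when the
  actions through \<open>A\<close> and through \<open>B\<close> agree.
\<close>

definition triangular_algebra ::
  "('r, 'a, 'x) module_scheme \<Rightarrow> ('r, 'b, 'y) module_scheme \<Rightarrow> ('a, 'm, 'b) bimodule
    \<Rightarrow> ('r, 'a \<times> 'm \<times> 'b) module"
  where "triangular_algebra A B M =
    \<lparr> carrier = carrier A \<times> carrier M \<times> carrier B,
      monoid.mult = (\<lambda>(a, m, b) (a', m', b').
                (a \<otimes>\<^bsub>A\<^esub> a', badd M (lact M a m') (ract M m b'), b \<otimes>\<^bsub>B\<^esub> b')),
      one = (\<one>\<^bsub>A\<^esub>, bzero M, \<one>\<^bsub>B\<^esub>),
      zero = (\<zero>\<^bsub>A\<^esub>, bzero M, \<zero>\<^bsub>B\<^esub>),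
      ring.add = (\<lambda>(a, m, b) (a', m', b'). (a \<oplus>\<^bsub>A\<^esub> a', badd M m m', b \<oplus>\<^bsub>B\<^esub> b')),
      module.smult = (\<lambda>c (a, m, b). (c \<odot>\<^bsub>A\<^esub> a, lact M (c \<odot>\<^bsub>A\<^esub> \<one>\<^bsub>A\<^esub>) m, c \<odot>\<^bsub>B\<^esub> b)) \<rparr>"


section \<open>Laurent series fields and the algebra \<open>\<Lambda>\<^sub>n\<close>\<close>

definition laurent_field :: "complex fls ring"
  where "laurent_field = ring_of_type_algebra"

text \<open>
  \<open>k\<^sub>n\<close> is the field of Laurent series in the indeterminate \<open>\<epsilon>\<^bsup>1/n\<^esup>\<close>: the coefficient of index
  \<open>j\<close> belongs to \<open>\<epsilon>\<^bsup>j/n\<^esup>\<close>. The field \<open>k\<close> embeds by \<open>\<epsilon> = (\<epsilon>\<^bsup>1/n\<^esup>)\<^sup>n\<close>, i.e. the coefficient of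
  index \<open>j\<close> moves to index \<open>n j\<close>.
\<close>

definition root_field :: "nat \<Rightarrow> (complex fls, complex fls) module"
  where "root_field n =
    ring.extend ring_of_type_algebra (module.fields (\<lambda>c x. fls_compose_power c n * x))"

lift_definition sigma :: "nat \<Rightarrow> complex fls \<Rightarrow> complex fls"
  is "\<lambda>n a j. exp (2 * of_real pi * \<i> / of_nat n) powi j * a j"
  by (auto elim: eventually_mono)

definition Lambda_bimodule :: "nat \<Rightarrow> (complex fls, complex fls \<times> complex fls, complex fls) bimodule"
  where "Lambda_bimodule n =
    bimodule_sum (regular_bimodule (root_field n))
                 (left_twist (sigma n) (regular_bimodule (root_field n)))"

definition Lambda ::
  "nat \<Rightarrow> (complex fls, complex fls \<times> (complex fls \<times> complex fls) \<times> complex fls) module"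
  where "Lambda n = triangular_algebra (root_field n) (root_field n) (Lambda_bimodule n)"


section \<open>Path algebras\<close>

text \<open>
  A quiver is a \<^type>\<open>pre_digraph\<close>. A path is a triple \<open>(u, p, v)\<close> of its source, its list of
  arrows in the order of traversal, and its target; \<open>(u, [], u)\<close> is the trivial path at \<open>u\<close>.
  The product of paths \<open>s t\<close> means first \<open>s\<close>, then \<open>t\<close>, and is \<open>0\<close> unless \<open>s\<close> ends where
  \<open>t\<close> starts. The unit is the sum of all trivial paths, so the quiver must have finitely
  many vertices.
\<close>

definition quiver_paths :: "('v, 'e) pre_digraph \<Rightarrow> ('v \<times> 'e list \<times> 'v) set"
  where "quiver_paths Q = {(u, p, v). pre_digraph.awalk Q u p v}"

definition path_factorizations ::
  "('v, 'e) pre_digraph \<Rightarrow> 'v \<times> 'e list \<times> 'v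
    \<Rightarrow> (('v \<times> 'e list \<times> 'v) \<times> ('v \<times> 'e list \<times> 'v)) set"
  where "path_factorizations Q w =
    {((u, p, x), (x, q, v)) | u p x q v.
       (u, p, x) \<in> quiver_paths Q \<and> (x, q, v) \<in> quiver_paths Q \<and> w = (u, p @ q, v)}"

definition path_algebra ::
  "('r, 'x) ring_scheme \<Rightarrow> ('v, 'e) pre_digraph \<Rightarrow> ('r, 'v \<times> 'e list \<times> 'v \<Rightarrow> 'r) module"
  where "path_algebra R Q =
    \<lparr> carrier = {f. (\<forall>w \<in> quiver_paths Q. f w \<in> carrier R) \<and>
                    (\<forall>w. w \<notin> quiver_paths Q \<longrightarrow> f w = \<zero>\<^bsub>R\<^esub>) \<and>
                    finite {w. f w \<noteq> \<zero>\<^bsub>R\<^esub>}},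
      monoid.mult = (\<lambda>f g w. \<Oplus>\<^bsub>R\<^esub>st \<in> path_factorizations Q w. f (fst st) \<otimes>\<^bsub>R\<^esub> g (snd st)),
      one = (\<lambda>w. if \<exists>v \<in> verts Q. w = (v, [], v) then \<one>\<^bsub>R\<^esub> else \<zero>\<^bsub>R\<^esub>),
      zero = (\<lambda>_. \<zero>\<^bsub>R\<^esub>),
      ring.add = (\<lambda>f g w. f w \<oplus>\<^bsub>R\<^esub> g w),
      module.smult = (\<lambda>c f w. c \<otimes>\<^bsub>R\<^esub> f w) \<rparr>"


section \<open>Crown quivers\<close>

text \<open>
  \<open>Source i\<close> and \<open>Sink i\<close> are the vertices \<open>i\<close> and \<open>i'\<close>, and \<open>Straight i\<close> and \<open>Skew i\<close> are the
  arrows \<open>\<alpha>\<^sub>i : i \<rightarrow> i'\<close> and \<open>\<alpha>\<^bsub>i'\<^esub> : i - 1 \<rightarrow> i'\<close>, with \<open>i - 1\<close> read as \<open>n\<close> for \<open>i = 1\<close>.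
\<close>

datatype crown_vertex = Source nat | Sink nat

datatype crown_arrow = Straight nat | Skew nat

definition crown_quiver :: "nat \<Rightarrow> (crown_vertex, crown_arrow) pre_digraph"
  where "crown_quiver n =
    \<lparr> verts = Source ` {1..n} \<union> Sink ` {1..n},
      arcs = Straight ` {1..n} \<union> Skew ` {1..n},
      tail = (\<lambda>e. case e of Straight i \<Rightarrow> Source i
                          | Skew i \<Rightarrow> Source (if i = 1 then n else i - 1)),
      head = (\<lambda>e. case e of Straight i \<Rightarrow> Sink i | Skew i \<Rightarrow> Sink i) \<rparr>"

end

theory Submission
  imports Defs
begin

text \<open>
  Write \<open>t = \<epsilon>\<^bsup>1/n\<^esup>\<close> and let \<open>F\<^sub>1, \<dots>, F\<^sub>n\<close> be the \<open>n\<close> embeddings of \<open>k\<^sub>n\<close> into \<open>k\<^sub>d\<close> over \<open>k\<close>,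
  numbered so that \<open>F\<^sub>i \<circ> \<sigma>\<^sub>n = F\<^bsub>i-1\<^esub>\<close> with cyclic indices. As for every Galois extension split by
  \<open>k\<^sub>d\<close>, the map \<open>s \<otimes> a \<mapsto> (s F\<^sub>i(a))\<^sub>i\<close> is an isomorphism from \<open>k\<^sub>d \<otimes>\<^sub>k k\<^sub>n\<close> to \<open>k\<^sub>d\<^sup>n\<close>. Applied to
  the two diagonal entries it splits each of the two diagonal idempotents of \<open>\<Lambda>\<^sub>n\<close> into \<open>n\<close>, which
  are the sources and the sinks of the crown quiver. The untwisted summand of the bimodule satisfies
  \<open>F\<^sub>i(a x b) = F\<^sub>i(a) F\<^sub>i(x) F\<^sub>i(b)\<close> and becomes the arrows from \<open>i\<close> to \<open>i'\<close>; in the twisted summand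
  \<open>F\<^sub>i(\<sigma>\<^sub>n(a) y b) = F\<^bsub>i-1\<^esub>(a) F\<^sub>i(y) F\<^sub>i(b)\<close>, so it becomes the arrows from \<open>i - 1\<close> to \<open>i'\<close>. As
  paths in the crown quiver have length at most one, nothing else has to be matched.

  The isomorphism is therefore given by applying the embeddings to all four entries
  (\<open>crown_hom\<close>), and \<open>crown_hom_mult\<close> is this computation. Bijectivity is
  proved by an explicit inverse (\<open>crown_section\<close>), which rests on the trace duality of the bases \<open>t\<^sup>j\<close> and
  \<open>t\<^sup>-\<^sup>j / n\<close> of \<open>k\<^sub>n\<close> over \<open>k\<close>: \<open>galois_embedding_orthogonal\<close> yields surjectivity, and
  \<open>sum_galois_embedding\<close> together with \<open>fls_eq_sum_sections\<close> yields injectivity.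

  The tensor product is a quotient of a free abelian group. The criterion
  \<open>algebra_isomorphic_base_changeI\<close> reduces statements about it to statements about
  representatives, where the inverse is only required to be one modulo the relations.
\<close>

unbundle fps_syntax


section \<open>Isomorphisms out of a base change\<close>

lemma free_tensor_ring_simps [simp]:
  "carrier (free_tensor_ring A B) = {f. Poly_Mapping.keys f \<subseteq> carrier A \<times> carrier B}"
  "\<one>\<^bsub>free_tensor_ring A B\<^esub> = frag_of (\<one>\<^bsub>A\<^esub>, \<one>\<^bsub>B\<^esub>)"
  "\<zero>\<^bsub>free_tensor_ring A B\<^esub> = 0"
  "f \<oplus>\<^bsub>free_tensor_ring A B\<^esub> g = f + g"
  by (simp_all add: free_tensor_ring_def)

lemma free_tensor_mult:
  "f \<otimes>\<^bsub>free_tensor_ring A B\<^esub> g = frag_extend (\<lambda>p. frag_extend (\<lambda>q.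
     frag_of (fst p \<otimes>\<^bsub>A\<^esub> fst q, snd p \<otimes>\<^bsub>B\<^esub> snd q)) g) f"
  by (simp add: free_tensor_ring_def case_prod_unfold)

lemma free_tensor_mult_frag_of [simp]:
  "frag_of (a, b) \<otimes>\<^bsub>free_tensor_ring A B\<^esub> frag_of (a', b') = frag_of (a \<otimes>\<^bsub>A\<^esub> a', b \<otimes>\<^bsub>B\<^esub> b')"
  by (simp add: free_tensor_mult)

lemma frag_extend_fun_diff:
  fixes F G :: "'a \<Rightarrow> 'b \<Rightarrow>\<^sub>0 int"
  shows "frag_extend (\<lambda>x. F x - G x) f = frag_extend F f - frag_extend G f"
proof -
  have "frag_cmul c (u - v) = frag_cmul c u - frag_cmul c v" for c and u v :: "'b \<Rightarrow>\<^sub>0 int"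
    by (rule poly_mapping_eqI) (simp add: lookup_minus right_diff_distrib)
  then show ?thesis
    by (simp add: frag_extend_def sum_subtractf)
qed

lemma free_tensor_mult_linear:
  "0 \<otimes>\<^bsub>free_tensor_ring A B\<^esub> g = 0"
  "f \<otimes>\<^bsub>free_tensor_ring A B\<^esub> 0 = 0"
  "(f - f') \<otimes>\<^bsub>free_tensor_ring A B\<^esub> g
     = f \<otimes>\<^bsub>free_tensor_ring A B\<^esub> g - f' \<otimes>\<^bsub>free_tensor_ring A B\<^esub> g"
  "f \<otimes>\<^bsub>free_tensor_ring A B\<^esub> (g - g')
     = f \<otimes>\<^bsub>free_tensor_ring A B\<^esub> g - f \<otimes>\<^bsub>free_tensor_ring A B\<^esub> g'"
  by (simp_all add: free_tensor_mult frag_extend_diff frag_extend_fun_diff frag_extend_eq_0)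

lemma free_tensor_mult_add:
  "(f + f') \<otimes>\<^bsub>free_tensor_ring A B\<^esub> g
     = f \<otimes>\<^bsub>free_tensor_ring A B\<^esub> g + f' \<otimes>\<^bsub>free_tensor_ring A B\<^esub> g"
  "f \<otimes>\<^bsub>free_tensor_ring A B\<^esub> (g + g')
     = f \<otimes>\<^bsub>free_tensor_ring A B\<^esub> g + f \<otimes>\<^bsub>free_tensor_ring A B\<^esub> g'"
  using free_tensor_mult_linear(3)[where f = "f + f'" and f' = f' and g = g and A = A and B = B]
    free_tensor_mult_linear(4)[where f = f and g = "g + g'" and g' = g' and A = A and B = B]
  by (simp_all add: algebra_simps)

text \<open>
  A nonempty set that is closed under subtraction is a subgroup, so one closure step suffices.
\<close>

lemma free_tensor_induct [consumes 1, case_names zero pure diff]: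
  assumes "f \<in> carrier (free_tensor_ring A B)"
    and "P 0"
    and "\<And>a b. a \<in> carrier A \<Longrightarrow> b \<in> carrier B \<Longrightarrow> P (frag_of (a, b))"
    and "\<And>f g. P f \<Longrightarrow> P g \<Longrightarrow> P (f - g)"
  shows "P f"
  by (rule frag_induction[of f "carrier A \<times> carrier B"]) (use assms in auto)

lemma keys_diff_subset:
  fixes f g :: "'a \<Rightarrow>\<^sub>0 int"
  assumes "Poly_Mapping.keys f \<subseteq> S" "Poly_Mapping.keys g \<subseteq> S"
  shows "Poly_Mapping.keys (f - g) \<subseteq> S"
  using assms keys_diff[of f g] by auto

lemma abelian_group_free_tensor_ring: "abelian_group (free_tensor_ring A B)"
proof (rule abelian_groupI)
  fix f assume f: "f \<in> carrier (free_tensor_ring A B)"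
  show "\<exists>g\<in>carrier (free_tensor_ring A B). g \<oplus>\<^bsub>free_tensor_ring A B\<^esub> f = \<zero>\<^bsub>free_tensor_ring A B\<^esub>"
    by (rule bexI[of _ "- f"]) (use f in auto)
next
  fix f g assume "f \<in> carrier (free_tensor_ring A B)" "g \<in> carrier (free_tensor_ring A B)"
  then show "f \<oplus>\<^bsub>free_tensor_ring A B\<^esub> g \<in> carrier (free_tensor_ring A B)"
    using Poly_Mapping.keys_add[of f g] by auto
qed (auto simp: add_ac)

lemma free_tensor_a_inv:
  assumes "f \<in> carrier (free_tensor_ring A B)"
  shows "\<ominus>\<^bsub>free_tensor_ring A B\<^esub> f = - f"
  by (rule abelian_group.minus_equality[OF abelian_group_free_tensor_ring]) (use assms in auto)

lemma ring_free_tensor_ring: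
  assumes "Group.monoid A" "Group.monoid B"
  shows "ring (free_tensor_ring A B)"
proof -
  let ?F = "free_tensor_ring A B"
  interpret A: Group.monoid A by fact
  interpret B: Group.monoid B by fact
  have closed: "f \<otimes>\<^bsub>?F\<^esub> g \<in> carrier ?F" if "f \<in> carrier ?F" "g \<in> carrier ?F" for f g
    using that(1)
  proof (induction rule: free_tensor_induct)
    case (pure a b)
    show ?case
      using that(2)
      by (induction rule: free_tensor_induct)
         (use pure in \<open>simp_all add: free_tensor_mult_linear keys_diff_subset\<close>)
  qed (simp_all add: free_tensor_mult_linear keys_diff_subset)
  have assoc: "f \<otimes>\<^bsub>?F\<^esub> g \<otimes>\<^bsub>?F\<^esub> h = f \<otimes>\<^bsub>?F\<^esub> (g \<otimes>\<^bsub>?F\<^esub> h)"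
    if f: "f \<in> carrier ?F" and g: "g \<in> carrier ?F" and h: "h \<in> carrier ?F" for f g h
    using f
  proof (induction rule: free_tensor_induct)
    case f: (pure a b)
    show ?case
      using g
    proof (induction rule: free_tensor_induct)
      case g: (pure a' b')
      show ?case
        using h
        by (induction rule: free_tensor_induct)
           (use f g in \<open>simp_all add: free_tensor_mult_linear A.m_assoc B.m_assoc\<close>)
    qed (simp_all add: free_tensor_mult_linear)
  qed (simp_all add: free_tensor_mult_linear)
  have one: "\<one>\<^bsub>?F\<^esub> \<otimes>\<^bsub>?F\<^esub> f = f \<and> f \<otimes>\<^bsub>?F\<^esub> \<one>\<^bsub>?F\<^esub> = f" if "f \<in> carrier ?F" for f
    using that by (induction rule: free_tensor_induct) (simp_all add: free_tensor_mult_linear)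
  have "Group.monoid ?F"
    using closed assoc one by (intro Group.monoidI) auto
  then show ?thesis
    using abelian_group_free_tensor_ring
    by (intro ringI) (auto simp: free_tensor_mult_add)
qed


lemma tensor_relations_cases [consumes 1, case_names left right balanced]:
  assumes "x \<in> tensor_relations R A B"
  obtains
    a a' b where "a \<in> carrier A" "a' \<in> carrier A" "b \<in> carrier B"
      "x = frag_of (a \<oplus>\<^bsub>A\<^esub> a', b) - frag_of (a, b) - frag_of (a', b)"
  | a b b' where "a \<in> carrier A" "b \<in> carrier B" "b' \<in> carrier B"
      "x = frag_of (a, b \<oplus>\<^bsub>B\<^esub> b') - frag_of (a, b) - frag_of (a, b')"
  | c a b where "c \<in> carrier R" "a \<in> carrier A" "b \<in> carrier B"
      "x = frag_of (c \<odot>\<^bsub>A\<^esub> a, b) - frag_of (a, c \<odot>\<^bsub>B\<^esub> b)"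
  using assms unfolding tensor_relations_def by blast

lemma tensor_ideal_relations:
  assumes "a \<in> carrier A" "b \<in> carrier B"
  shows "a' \<in> carrier A \<Longrightarrow>
      frag_of (a \<oplus>\<^bsub>A\<^esub> a', b) - frag_of (a, b) - frag_of (a', b) \<in> tensor_ideal R A B"
    and "b' \<in> carrier B \<Longrightarrow>
      frag_of (a, b \<oplus>\<^bsub>B\<^esub> b') - frag_of (a, b) - frag_of (a, b') \<in> tensor_ideal R A B"
    and "c \<in> carrier R \<Longrightarrow>
      frag_of (c \<odot>\<^bsub>A\<^esub> a, b) - frag_of (a, c \<odot>\<^bsub>B\<^esub> b) \<in> tensor_ideal R A B"
proof -
  have incl: "x \<in> tensor_ideal R A B" if "x \<in> tensor_relations R A B" for x
    using that unfolding tensor_ideal_def by (rule generate.incl)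
  show "frag_of (a \<oplus>\<^bsub>A\<^esub> a', b) - frag_of (a, b) - frag_of (a', b) \<in> tensor_ideal R A B"
    if "a' \<in> carrier A"
    by (rule incl, unfold tensor_relations_def, rule UnI1, rule UnI1, intro CollectI exI conjI,
        rule refl) (use assms that in auto)
  show "frag_of (a, b \<oplus>\<^bsub>B\<^esub> b') - frag_of (a, b) - frag_of (a, b') \<in> tensor_ideal R A B"
    if "b' \<in> carrier B"
    by (rule incl, unfold tensor_relations_def, rule UnI1, rule UnI2, intro CollectI exI conjI,
        rule refl) (use assms that in auto)
  show "frag_of (c \<odot>\<^bsub>A\<^esub> a, b) - frag_of (a, c \<odot>\<^bsub>B\<^esub> b) \<in> tensor_ideal R A B"
    if "c \<in> carrier R"
    by (rule incl, unfold tensor_relations_def, rule UnI2, intro CollectI exI conjI,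
        rule refl) (use assms that in auto)
qed

lemma subgroup_tensor_ideal:
  assumes "tensor_relations R A B \<subseteq> carrier (free_tensor_ring A B)"
  shows "subgroup (tensor_ideal R A B) (add_monoid (free_tensor_ring A B))"
proof -
  interpret F: abelian_group "free_tensor_ring A B" by (rule abelian_group_free_tensor_ring)
  show ?thesis
    unfolding tensor_ideal_def using assms by (intro F.add.generate_is_subgroup) simp
qed

lemma tensor_ideal_zero: "0 \<in> tensor_ideal R A B"
  using generate.one[of "add_monoid (free_tensor_ring A B)" "tensor_relations R A B"]
  by (simp add: tensor_ideal_def)

lemma tensor_ideal_diff:
  assumes "tensor_relations R A B \<subseteq> carrier (free_tensor_ring A B)"
    and "x \<in> tensor_ideal R A B" "y \<in> tensor_ideal R A B"
  shows "x - y \<in> tensor_ideal R A B"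
proof -
  interpret G: subgroup "tensor_ideal R A B" "add_monoid (free_tensor_ring A B)"
    by (rule subgroup_tensor_ideal) fact
  show ?thesis
    using G.m_closed[OF assms(2) G.m_inv_closed[OF assms(3)]] G.mem_carrier[OF assms(3)]
      free_tensor_a_inv[of y A B]
    by (simp add: a_inv_def)
qed

text \<open>
  Passing to the quotient by the relations is avoided: identities between tensors are written as
  membership of a difference in the subgroup \<open>I\<close> of relations. The two additivity relations then
  extend from two to finitely many summands, in either argument.
\<close>

lemma additive_modulo_sum:
  fixes F :: "'a::ab_group_add \<Rightarrow> 'b::ab_group_add"
  assumes zero: "0 \<in> I" and diff: "\<And>x y. x \<in> I \<Longrightarrow> y \<in> I \<Longrightarrow> x - y \<in> I"
    and add: "\<And>a b. F (a + b) - F a - F b \<in> I"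
  shows "F (sum f J) - (\<Sum>j\<in>J. F (f j)) \<in> I"
proof -
  have uminus: "- x \<in> I" if "x \<in> I" for x
    using diff[OF zero that] by simp
  have plus: "x + y \<in> I" if "x \<in> I" "y \<in> I" for x y
    using diff[OF that(1) uminus[OF that(2)]] by simp
  have "F 0 \<in> I"
    using uminus[OF add[of 0 0]] by simp
  then show ?thesis
  proof (induction J rule: infinite_finite_induct)
    case (insert j J)
    then show ?case
      using plus[OF add[of "f j" "sum f J"] insert.IH] by (simp add: algebra_simps)
  qed simp_all
qed

text \<open>
  A map \<open>\<psi>\<close> that sends \<open>h x\<close> back to the class of \<open>x\<close> makes \<open>h\<close> injective modulo the relations:
  if \<open>h x = h 0\<close>, then \<open>x\<close> and \<open>0\<close> are both congruent to \<open>\<psi> (h 0)\<close>. So \<open>\<psi>\<close> chooses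
  representatives for the values of the inverse isomorphism.
\<close>

lemma kernel_eq_tensor_ideal:
  assumes rel: "tensor_relations R A B \<subseteq> carrier (free_tensor_ring A B)"
    and hom: "ring_hom_ring (free_tensor_ring A B) P h"
    and balanced: "\<And>x. x \<in> tensor_relations R A B \<Longrightarrow> h x = \<zero>\<^bsub>P\<^esub>"
    and sect: "\<And>x. x \<in> carrier (free_tensor_ring A B) \<Longrightarrow> \<psi> (h x) - x \<in> tensor_ideal R A B"
  shows "a_kernel (free_tensor_ring A B) P h = tensor_ideal R A B"
proof
  let ?F = "free_tensor_ring A B"
  interpret ring_hom_ring ?F P h by fact
  show "a_kernel ?F P h \<subseteq> tensor_ideal R A B"
  proof
    fix x assume x: "x \<in> a_kernel ?F P h"
    then have x: "x \<in> carrier ?F" "h x = \<zero>\<^bsub>P\<^esub>"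
      unfolding a_kernel_def' by blast+
    have "h \<zero>\<^bsub>?F\<^esub> = \<zero>\<^bsub>P\<^esub>"
      by (rule hom_zero)
    then have "h 0 = h x"
      using x(2) by (simp only: free_tensor_ring_simps(3))
    then have "x = (\<psi> (h 0) - 0) - (\<psi> (h x) - x)"
      by simp
    also have "\<dots> \<in> tensor_ideal R A B"
      using tensor_ideal_diff[OF rel sect[of 0] sect[OF x(1)]] by simp
    finally show "x \<in> tensor_ideal R A B" .
  qed
  interpret K: subgroup "a_kernel ?F P h" "add_monoid ?F"
    by (intro additive_subgroup.a_subgroup ideal.axioms(1) kernel_is_ideal)
  have "tensor_relations R A B \<subseteq> a_kernel ?F P h"
    using rel balanced unfolding a_kernel_def' by blast
  then show "tensor_ideal R A B \<subseteq> a_kernel ?F P h"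
    unfolding tensor_ideal_def
    by (intro R.add.generate_subgroup_incl K.subgroup_axioms)
qed

text \<open>
  The first isomorphism theorem applied to the linear extension \<open>h\<close> of a map on pure tensors. It
  also shows that \<open>P\<close> is a ring and that the relations form an ideal: \<open>P\<close> is the image of the
  ring \<^const>\<open>free_tensor_ring\<close> under \<open>h\<close>, and the relations generate the kernel.
\<close>

lemma algebra_isomorphic_base_changeI:
  assumes mon: "Group.monoid S" "Group.monoid A"
    and rel: "tensor_relations R S A \<subseteq> carrier (free_tensor_ring S A)"
    and hom: "h \<in> ring_hom (free_tensor_ring S A) P"
    and zero: "h 0 = \<zero>\<^bsub>P\<^esub>"
    and surj: "h ` carrier (free_tensor_ring S A) = carrier P"
    and balanced: "\<And>x. x \<in> tensor_relations R S A \<Longrightarrow> h x = \<zero>\<^bsub>P\<^esub>"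
    and sect: "\<And>x. x \<in> carrier (free_tensor_ring S A) \<Longrightarrow> \<psi> (h x) - x \<in> tensor_ideal R S A"
    and scalar: "\<And>s z. s \<in> carrier S \<Longrightarrow> z \<in> carrier P
                   \<Longrightarrow> h (frag_of (s, \<one>\<^bsub>A\<^esub>)) \<otimes>\<^bsub>P\<^esub> z = s \<odot>\<^bsub>P\<^esub> z"
  shows "algebra_isomorphic S (base_change R S A) P"
proof -
  let ?F = "free_tensor_ring S A" and ?T = "tensor_ring R S A"
  interpret F: ring ?F by (rule ring_free_tensor_ring) fact+
  interpret A: Group.monoid A by fact
  \<comment> \<open>The image of a ring homomorphism carries its own carrier and zero; by surjectivity these are
    the ones of \<open>P\<close>.\<close>
  let ?P = "P\<lparr>carrier := carrier P, zero := \<zero>\<^bsub>P\<^esub>\<rparr>"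
  have "ring ?P"
    using F.ring_hom_imp_img_ring[OF hom] by (simp only: surj free_tensor_ring_simps(3) zero)
  then interpret P: ring P by simp
  interpret h: ring_hom_ring ?F P h
    by (rule ring_hom_ringI2) (use hom F.ring_axioms P.ring_axioms in auto)
  have ker: "a_kernel ?F P h = tensor_ideal R S A"
    using rel h.ring_hom_ring_axioms balanced sect by (rule kernel_eq_tensor_ideal)
  define Phi where "Phi = (\<lambda>C. the_elem (h ` C))"
  have iso: "Phi \<in> ring_iso ?T P"
    using h.FactRing_iso_set[OF surj] by (simp add: Phi_def ker tensor_ring_def)
  have pure: "Phi (pure_tensor R S A s \<one>\<^bsub>A\<^esub>) = h (frag_of (s, \<one>\<^bsub>A\<^esub>))
      \<and> pure_tensor R S A s \<one>\<^bsub>A\<^esub> \<in> carrier ?T" if "s \<in> carrier S" for s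
  proof -
    have "frag_of (s, \<one>\<^bsub>A\<^esub>) \<in> carrier ?F"
      using that by simp
    then show ?thesis
      using h.the_elem_simp[of "frag_of (s, \<one>\<^bsub>A\<^esub>)"] that
      by (auto simp: Phi_def ker pure_tensor_def tensor_ring_def FactRing_def A_RCOSETS_def'
          intro!: exI[of _ "frag_of (s, \<one>\<^bsub>A\<^esub>)"])
  qed
  have "Phi \<in> algebra_iso S (base_change R S A) P"
    unfolding algebra_iso_def
  proof (intro CollectI conjI ballI)
    show "Phi \<in> ring_iso (base_change R S A) P"
      using iso by (simp add: ring_iso_def ring_hom_def base_change_def ring.defs)
    fix s z assume s: "s \<in> carrier S" and "z \<in> carrier (base_change R S A)"
    then have z: "z \<in> carrier ?T"
      by (simp add: base_change_def ring.defs)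
    have "Phi (pure_tensor R S A s \<one>\<^bsub>A\<^esub> \<otimes>\<^bsub>?T\<^esub> z) = h (frag_of (s, \<one>\<^bsub>A\<^esub>)) \<otimes>\<^bsub>P\<^esub> Phi z"
      using iso pure[OF s] z ring_hom_mult[of Phi ?T P] by (simp add: ring_iso_def)
    also have "\<dots> = s \<odot>\<^bsub>P\<^esub> Phi z"
      using iso z s by (intro scalar) (auto simp: ring_iso_def ring_hom_def)
    finally show "Phi (s \<odot>\<^bsub>base_change R S A\<^esub> z) = s \<odot>\<^bsub>P\<^esub> Phi z"
      by (simp add: base_change_def ring.defs module.defs)
  qed
  then show ?thesis
    by (auto simp: algebra_isomorphic_def)
qed


section \<open>Additive extension from a free abelian group\<close>

text \<open>
  The analogue of \<^const>\<open>frag_extend\<close> with values in a ring instead of a free abelian group.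
\<close>

definition frag_eval :: "('a \<Rightarrow> 'b::ring_1) \<Rightarrow> ('a \<Rightarrow>\<^sub>0 int) \<Rightarrow> 'b"
  where "frag_eval \<phi> f = (\<Sum>p\<in>Poly_Mapping.keys f. of_int (Poly_Mapping.lookup f p) * \<phi> p)"

lemma frag_eval_superset:
  assumes "finite S" "Poly_Mapping.keys f \<subseteq> S"
  shows "frag_eval \<phi> f = (\<Sum>p\<in>S. of_int (Poly_Mapping.lookup f p) * \<phi> p)"
  unfolding frag_eval_def
  by (intro sum.mono_neutral_left) (use assms in \<open>auto simp: in_keys_iff\<close>)

lemma frag_eval_0 [simp]: "frag_eval \<phi> 0 = 0"
  by (simp add: frag_eval_def)

lemma frag_eval_frag_of [simp]: "frag_eval \<phi> (frag_of p) = \<phi> p"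
  by (simp add: frag_eval_def)

lemma frag_eval_add: "frag_eval \<phi> (f + g) = frag_eval \<phi> f + frag_eval \<phi> g"
proof -
  let ?S = "Poly_Mapping.keys f \<union> Poly_Mapping.keys g"
  have "frag_eval \<phi> h = (\<Sum>p\<in>?S. of_int (Poly_Mapping.lookup h p) * \<phi> p)"
    if "Poly_Mapping.keys h \<subseteq> ?S" for h
    using that by (intro frag_eval_superset) simp_all
  from this[of f] this[of g] this[of "f + g"] show ?thesis
    using Poly_Mapping.keys_add[of f g]
    by (simp add: lookup_add distrib_right sum.distrib)
qed

lemma frag_eval_diff: "frag_eval \<phi> (f - g) = frag_eval \<phi> f - frag_eval \<phi> g"
  using frag_eval_add[of \<phi> "f - g" g] by simp

lemma frag_eval_sum: "frag_eval \<phi> (sum f J) = (\<Sum>j\<in>J. frag_eval \<phi> (f j))"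
  by (induction J rule: infinite_finite_induct) (simp_all add: frag_eval_add)


section \<open>Embeddings of Laurent series fields\<close>

text \<open>
  Substitution of \<open>z X\<close> for \<open>X\<close>. Both \<^const>\<open>sigma\<close> and the embeddings of \<open>k\<^sub>n\<close> below are
  built from dilations by roots of unity.
\<close>

lift_definition fls_dilate :: "'a::field \<Rightarrow> 'a fls \<Rightarrow> 'a fls"
  is "\<lambda>z a j. z powi j * a j"
  by (auto elim: eventually_mono)

lemma fls_dilate_nth [simp]: "fls_dilate z f $$ j = z powi j * f $$ j"
  by (simp add: fls_dilate.rep_eq)

lemma fls_subdegree_dilate [simp]:
  assumes "z \<noteq> 0"
  shows "fls_subdegree (fls_dilate z f) = fls_subdegree f"
proof (cases "f = 0")
  case False
  then show ?thesis
    using assms by (intro fls_subdegree_eqI) auto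
next
  case True
  then have "fls_dilate z f = 0"
    by (intro fls_eqI) simp
  with True show ?thesis by simp
qed

lemma fls_dilate_add: "fls_dilate z (f + g) = fls_dilate z f + fls_dilate z g"
  by (intro fls_eqI) (simp add: distrib_left)

lemma fls_dilate_mult:
  assumes "z \<noteq> 0"
  shows "fls_dilate z (f * g) = fls_dilate z f * fls_dilate z g"
proof (rule fls_eqI)
  fix j
  have "z powi j = z powi i * z powi (j - i)" for i
    using assms by (simp flip: power_int_add)
  then show "fls_dilate z (f * g) $$ j = (fls_dilate z f * fls_dilate z g) $$ j"
    using assms by (simp add: fls_times_nth(2) sum_distrib_left mult_ac)
qed

lemma fls_dilate_1 [simp]: "fls_dilate z 1 = 1"
  by (intro fls_eqI) simp

lemma fls_dilate_0 [simp]: "fls_dilate z 0 = 0"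
  by (intro fls_eqI) simp

lemma fls_dilate_dilate: "fls_dilate z (fls_dilate w f) = fls_dilate (z * w) f"
  by (intro fls_eqI) (simp add: power_int_mult_distrib)

definition unity_root :: "nat \<Rightarrow> complex"
  where "unity_root n = exp (2 * of_real pi * \<i> / of_nat n)"

lemma unity_root_nonzero [simp]: "unity_root n \<noteq> 0"
  by (simp add: unity_root_def)

lemma sigma_eq_dilate: "sigma n = fls_dilate (unity_root n)"
  by (intro ext fls_eqI) (simp add: sigma.rep_eq unity_root_def)

lemma unity_root_powi_eq_1_iff:
  assumes "n > 0"
  shows "unity_root n powi r = 1 \<longleftrightarrow> int n dvd r"
proof -
  have "unity_root n powi r = exp (of_int r * (2 * of_real pi * \<i> / of_nat n))"
    by (simp add: unity_root_def exp_power_int)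
  also have "\<dots> = 1 \<longleftrightarrow> (\<exists>q::int. of_int r / of_nat n = (of_int q :: real))"
    using assms by (auto simp: exp_eq_1 field_simps)
  also have "\<dots> \<longleftrightarrow> int n dvd r"
  proof -
    have "of_int r / of_nat n = (of_int q :: real) \<longleftrightarrow> r = int n * q" for q
      using assms by (simp add: field_simps) (metis of_int_eq_iff of_int_mult of_int_of_nat_eq)
    then show ?thesis by (auto simp: dvd_def)
  qed
  finally show ?thesis .
qed

lemma sum_unity_root_powi:
  assumes "n > 0"
  shows "(\<Sum>j<n. unity_root n powi (int j * r)) = (if int n dvd r then of_nat n else 0)"
proof -
  let ?w = "unity_root n powi r"
  have w: "unity_root n powi (int j * r) = ?w ^ j" for j
    by (simp add: mult.commute[of "int j"] power_int_mult)
  have "?w ^ n = unity_root n powi (int n * r)"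
    by (simp add: w)
  also have "\<dots> = 1"
    using assms by (simp add: unity_root_powi_eq_1_iff)
  finally have "?w ^ n = 1" .
  then show ?thesis
    using assms unity_root_powi_eq_1_iff[of n r] by (auto simp: w geometric_sum)
qed

text \<open>
  The embeddings of \<open>k\<^sub>n\<close> into \<open>k\<^sub>d\<close> over \<open>k\<close>: first \<open>\<sigma>\<^sub>n\<^sup>-\<^sup>i\<close>, then \<open>\<epsilon>\<^bsup>1/n\<^esup> \<mapsto> (\<epsilon>\<^bsup>1/d\<^esup>)\<^bsup>d/n\<^esup>\<close>. The
  negative exponent is what makes a left multiplication twisted by \<open>\<sigma>\<^sub>n\<close> appear at the source
  \<open>i - 1\<close> of a skew arrow into \<open>i'\<close>; with \<open>\<sigma>\<^sub>n\<^sup>i\<close> it would appear at the source \<open>i + 1\<close>.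
\<close>

definition galois_embedding :: "nat \<Rightarrow> nat \<Rightarrow> nat \<Rightarrow> complex fls \<Rightarrow> complex fls"
  where "galois_embedding n d i a =
    fls_compose_power (fls_dilate (unity_root n powi - int i) a) (d div n)"

lemma galois_embedding_add:
  "galois_embedding n d i (a + b) = galois_embedding n d i a + galois_embedding n d i b"
  by (simp add: galois_embedding_def fls_dilate_add)

lemma galois_embedding_mult:
  "galois_embedding n d i (a * b) = galois_embedding n d i a * galois_embedding n d i b"
  by (simp add: galois_embedding_def fls_dilate_mult)

lemma galois_embedding_0 [simp]: "galois_embedding n d i 0 = 0"
  by (simp add: galois_embedding_def)

lemma galois_embedding_1 [simp]:
  assumes "n > 0" "d > 0" "n dvd d"
  shows "galois_embedding n d i 1 = 1"
  using assms by (auto simp: galois_embedding_def)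

text \<open>
  The index is cyclic because \<open>\<zeta>\<^sub>n\<^sup>n = 1\<close>, so that \<open>0\<close> may be read as \<open>n\<close>, exactly as in the
  crown quiver.
\<close>

lemma galois_embedding_sigma:
  assumes "n > 0" "i \<in> {1..n}"
  shows "galois_embedding n d i (sigma n a) = galois_embedding n d (if i = 1 then n else i - 1) a"
proof -
  have "unity_root n powi - int i * unity_root n =
      unity_root n powi - int (if i = 1 then n else i - 1)"
  proof (cases "i = 1")
    case True
    then show ?thesis
      using unity_root_powi_eq_1_iff[OF assms(1), of "- int n"] by (simp add: power_int_minus)
  next
    case False
    then have *: "- int i + 1 = - int (if i = 1 then n else i - 1)"
      using assms(2) by auto
    have "unity_root n powi - int i * unity_root n = unity_root n powi (- int i + 1)"
      by (rule power_int_add_1[symmetric]) simp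
    then show ?thesis
      unfolding * .
  qed
  then show ?thesis
    by (simp only: galois_embedding_def sigma_eq_dilate fls_dilate_dilate)
qed

lemma galois_embedding_base_field:
  assumes "n > 0" "d > 0" "n dvd d"
  shows "galois_embedding n d i (fls_compose_power c n) = fls_compose_power c d"
proof -
  obtain m where m: "d = n * m" "m > 0"
    using assms by auto
  have *: "unity_root n powi (- int i * r) = 1" if "int n dvd r" for r
    using that assms by (simp add: unity_root_powi_eq_1_iff del: mult_minus_left)
  have "fls_dilate (unity_root n powi - int i) (fls_compose_power c n) = fls_compose_power c n"
    using assms * by (intro fls_eqI) (simp add: fls_nth_compose_power flip: power_int_mult)
  moreover have "fls_compose_power (fls_compose_power c n) m = fls_compose_power c d"
    using m assms
    by (intro fls_eqI) (auto simp: fls_nth_compose_power zdiv_zmult2_eq mult.commute[of "int n"] 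
       dvd_div_iff_mult dvd_mult_left)
  ultimately show ?thesis
    using m assms by (simp add: galois_embedding_def)
qed

text \<open>
  With respect to the basis \<open>1, t, \<dots>, t\<^bsup>n-1\<^esup>\<close> of \<open>k\<^sub>n\<close> over \<open>k\<close>, where \<open>t = \<epsilon>\<^bsup>1/n\<^esup>\<close>, this is the
  \<open>j\<close>-th coordinate of \<open>a\<close> for \<open>j < n\<close>.
\<close>

definition fls_section :: "nat \<Rightarrow> nat \<Rightarrow> 'a::zero fls \<Rightarrow> 'a fls"
  where "fls_section n j a = Abs_fls (\<lambda>r. a $$ (int n * r + int j))"

lemma fls_section_nth:
  assumes "n > 0"
  shows "fls_section n j a $$ r = a $$ (int n * r + int j)"
  unfolding fls_section_def
proof (rule nth_Abs_fls_lower_bound)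
  show "\<forall>r < min 0 (fls_subdegree a) - int j. a $$ (int n * r + int j) = 0"
  proof (intro allI impI)
    fix r :: int assume r: "r < min 0 (fls_subdegree a) - int j"
    then have "int n * r \<le> 1 * r"
      using assms by (intro mult_right_mono_neg) auto
    with r show "a $$ (int n * r + int j) = 0"
      by (intro fls_eq0_below_subdegree) auto
  qed
qed

lemma fls_eq_sum_sections:
  fixes a :: "'a::comm_ring_1 fls"
  assumes "n > 0"
  shows "a = (\<Sum>j<n. fls_compose_power (fls_section n j a) n * fls_X_intpow (int j))"
proof (rule fls_eqI)
  fix l :: int
  define j0 where "j0 = nat (l mod int n)"
  have j0: "int n dvd l - int j \<longleftrightarrow> j = j0" if "j < n" for j
  proof -
    have "int n dvd l - int j \<longleftrightarrow> l mod int n = int j mod int n"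
      by (simp add: mod_eq_dvd_iff)
    also have "\<dots> \<longleftrightarrow> j = j0"
      using that by (auto simp: j0_def)
    finally show ?thesis .
  qed
  have "j0 < n" using assms by (simp add: j0_def nat_less_iff)
  have "(\<Sum>j<n. fls_compose_power (fls_section n j a) n * fls_X_intpow (int j)) $$ l
      = (\<Sum>j<n. if j = j0 then a $$ l else 0)"
    unfolding fls_nth_sum using assms
    by (intro sum.cong refl)
       (auto simp: fls_X_intpow_times_conv_shift fls_nth_compose_power fls_section_nth j0)
  also have "\<dots> = a $$ l"
    using \<open>j0 < n\<close> by simp
  finally show "a $$ l = (\<Sum>j<n. fls_compose_power (fls_section n j a) n * fls_X_intpow (int j)) $$ l"
    by simp
qed

lemma galois_embedding_nth:
  assumes "n > 0" "d > 0" "n dvd d"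
  shows "galois_embedding n d i a $$ l = (if int (d div n) dvd l
    then unity_root n powi (- int i * (l div int (d div n))) * a $$ (l div int (d div n)) else 0)"
  using assms
  by (auto simp: galois_embedding_def fls_nth_compose_power power_int_mult simp del: mult_minus_left)

lemma galois_embedding_X_intpow_shift:
  assumes "n > 0" "m > 0"
  shows "galois_embedding n (n * m) i (a * fls_X_intpow (- j)) $$ (int m * r)
       = unity_root n powi (- int i * r) * a $$ (r + j)"
proof -
  have "(a * fls_X_intpow (- j)) $$ r = a $$ (r + j)"
    by (subst fls_X_intpow_times_conv_shift(2)) simp
  then show ?thesis
    using assms galois_embedding_nth[of n "n * m" i "a * fls_X_intpow (- j)" "int m * r"]
    by (simp del: mult_minus_left fls_X_intpow_times_conv_shift)
qed

text \<open>
  The left-hand side is the image in \<open>k\<^sub>d\<close> of the trace of \<open>a t\<^sup>-\<^sup>j\<close> from \<open>k\<^sub>n\<close> to \<open>k\<close>,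
  and the trace of \<open>t\<^sup>r\<close> vanishes unless \<open>n\<close> divides \<open>r\<close>. So \<open>t\<^sup>-\<^sup>j / n\<close> is the trace-dual basis of \<open>t\<^sup>j\<close>.
\<close>

lemma sum_galois_embedding:
  assumes "n > 0" "d > 0" "n dvd d"
  shows "(\<Sum>i=1..n. galois_embedding n d i (a * fls_X_intpow (- int j)))
       = fls_const (of_nat n) * fls_compose_power (fls_section n j a) d"
proof (rule fls_eqI)
  fix l :: int
  obtain m where m: "d = n * m" "m > 0"
    using assms by auto
  have sum: "(\<Sum>i=1..n. unity_root n powi (- int i * r)) = (if int n dvd r then of_nat n else 0)"
    for r
  proof -
    have "(\<Sum>i=1..n. unity_root n powi (- int i * r)) = (\<Sum>i<n. unity_root n powi (- int (Suc i) * r))"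
      by (rule sum.reindex_bij_witness[of _ Suc "\<lambda>i. i - 1"]) auto
    also have "\<dots> = unity_root n powi (- r) * (\<Sum>i<n. unity_root n powi (int i * (- r)))"
      by (simp add: sum_distrib_left algebra_simps flip: power_int_add)
    also have "\<dots> = (if int n dvd r then of_nat n else 0)"
      using assms unity_root_powi_eq_1_iff[of n "- r"]
      by (simp add: sum_unity_root_powi del: mult_minus_right)
    finally show ?thesis .
  qed
  show "(\<Sum>i=1..n. galois_embedding n d i (a * fls_X_intpow (- int j))) $$ l
      = (fls_const (of_nat n) * fls_compose_power (fls_section n j a) d) $$ l"
  proof (cases "int m dvd l")
    case True
    then obtain r where r: "l = int m * r" by auto
    have "(\<Sum>i=1..n. galois_embedding n d i (a * fls_X_intpow (- int j))) $$ l
        = (\<Sum>i=1..n. unity_root n powi (- int i * r) * a $$ (r + int j))"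
      unfolding fls_nth_sum r m(1)
      by (intro sum.cong refl galois_embedding_X_intpow_shift assms m)
    also have "\<dots> = (\<Sum>i=1..n. unity_root n powi (- int i * r)) * a $$ (r + int j)"
      by (simp only: sum_distrib_right)
    also have "\<dots> = (if int n dvd r then of_nat n else 0) * a $$ (r + int j)"
      by (simp only: sum)
    also have "\<dots> = (fls_const (of_nat n) * fls_compose_power (fls_section n j a) d) $$ l"
    proof -
      have "int d dvd l \<longleftrightarrow> int n dvd r"
        using m by (simp add: r mult.commute[of "int n"])
      moreover have "int n * (l div int d) = r" if "int n dvd r"
        using that m assms by (auto simp: r)
      ultimately show ?thesis
        using assms by (simp add: fls_nth_compose_power fls_section_nth)
    qed
    finally show ?thesis .
  next
    case False
    then have "\<not> int d dvd l"
      using m by (auto dest: dvd_mult_right)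
    then show ?thesis
      using False m assms by (simp add: fls_nth_sum galois_embedding_nth fls_nth_compose_power)
  qed
qed

lemma galois_embedding_X_intpow:
  assumes "n > 0" "d > 0" "n dvd d"
  shows "galois_embedding n d i (fls_X_intpow j)
       = fls_const (unity_root n powi (- int i * j)) * fls_X_intpow (int (d div n) * j)"
proof -
  have "d div n > 0" using assms by auto
  then show ?thesis
    using assms by (intro fls_eqI) (auto simp: galois_embedding_nth)
qed

lemma fls_const_sum: "fls_const (sum f J) = (\<Sum>j\<in>J. fls_const (f j))"
  by (induction J rule: infinite_finite_induct) (simp_all flip: fls_plus_const)

text \<open>
  Duality of the two bases from the other side: the matrices \<open>(F\<^sub>i (t\<^sup>j))\<close> and
  \<open>(F\<^sub>i (t\<^sup>-\<^sup>j) / n)\<close>, transposed, are inverse to each other. This is the independence of the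
  \<open>n\<close> embeddings in explicit form.
\<close>

lemma galois_embedding_orthogonal:
  assumes "n > 0" "d > 0" "n dvd d" "i \<in> {1..n}" "i' \<in> {1..n}"
  shows "(\<Sum>j<n. galois_embedding n d i' (fls_X_intpow (- int j))
                * galois_embedding n d i (fls_X_intpow (int j)))
       = (if i = i' then fls_const (of_nat n) else 0)"
proof -
  let ?F = "galois_embedding n d" and ?z = "unity_root n"
  have "?F i' (fls_X_intpow (- int j)) * ?F i (fls_X_intpow (int j))
      = fls_const (?z powi (int j * (int i' - int i)))" for j
  proof -
    let ?X = "fls_X_intpow :: int \<Rightarrow> complex fls" and ?k = "int (d div n) * int j"
    have "?F i' (fls_X_intpow (- int j)) * ?F i (fls_X_intpow (int j))
        = (fls_const (?z powi (- int i' * - int j)) * ?X (int (d div n) * - int j))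
        * (fls_const (?z powi (- int i * int j)) * ?X ?k)"
      by (simp only: galois_embedding_X_intpow[OF assms(1-3)])
    also have "\<dots> = fls_const (?z powi (- int i' * - int j) * ?z powi (- int i * int j))
        * (?X (- ?k) * ?X ?k)"
      by (simp only: fls_const_mult_const[symmetric] mult_ac mult_minus_right mult_minus_left)
    also have "?X (- ?k) * ?X ?k = 1"
      by (simp add: fls_shifted_times_simps)
    also have "?z powi (- int i' * - int j) * ?z powi (- int i * int j)
        = ?z powi (int j * (int i' - int i))"
      by (simp add: algebra_simps flip: power_int_add)
    finally show ?thesis by simp
  qed
  then have "(\<Sum>j<n. ?F i' (fls_X_intpow (- int j)) * ?F i (fls_X_intpow (int j)))
      = fls_const (\<Sum>j<n. ?z powi (int j * (int i' - int i)))"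
    by (simp only: fls_const_sum)
  also have "\<dots> = (if i = i' then fls_const (of_nat n) else 0)"
  proof -
    have "int n dvd int i' - int i \<longleftrightarrow> i = i'"
      using assms(4,5) dvd_imp_le_int[of "int i' - int i" "int n"]
      by (cases "i' = i") auto
    then show ?thesis
      using assms by (simp add: sum_unity_root_powi)
  qed
  finally show ?thesis .
qed

lemma sigma_simps [simp]:
  "sigma n 0 = 0" "sigma n 1 = 1"
  "sigma n (x + y) = sigma n x + sigma n y"
  "sigma n (x * y) = sigma n x * sigma n y"
  by (simp_all add: sigma_eq_dilate fls_dilate_add fls_dilate_mult)

lemma sigma_fixes_base_field:
  assumes "n > 0"
  shows "sigma n (fls_compose_power c n) = fls_compose_power c n"
proof (rule fls_eqI)
  fix j
  show "sigma n (fls_compose_power c n) $$ j = fls_compose_power c n $$ j"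
    using assms unity_root_powi_eq_1_iff[of n j] by (simp add: sigma_eq_dilate fls_nth_compose_power)
qed


section \<open>Laurent series fields as record structures\<close>

lemma root_field_simps [simp]:
  "carrier (root_field n) = UNIV"
  "x \<otimes>\<^bsub>root_field n\<^esub> y = x * y"
  "\<one>\<^bsub>root_field n\<^esub> = 1"
  "\<zero>\<^bsub>root_field n\<^esub> = 0"
  "x \<oplus>\<^bsub>root_field n\<^esub> y = x + y"
  "c \<odot>\<^bsub>root_field n\<^esub> x = fls_compose_power c n * x"
  by (simp_all add: root_field_def ring_of_type_algebra_def ring.defs module.defs)

lemma laurent_field_carrier [simp]: "carrier laurent_field = UNIV"
  by (simp add: laurent_field_def ring_of_type_algebra_def)

lemma monoid_root_field: "Group.monoid (root_field n)"
  by (intro Group.monoidI) (simp_all add: mult.assoc)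

lemma abelian_monoid_root_field: "abelian_monoid (root_field n)"
  by (intro abelian_monoidI) (simp_all add: add_ac)

lemma finsum_root_field:
  assumes "finite J"
  shows "finsum (root_field n) f J = sum f J"
proof -
  interpret abelian_monoid "root_field n" by (rule abelian_monoid_root_field)
  show ?thesis
    using assms by (induction J) simp_all
qed


section \<open>Paths in the crown quiver\<close>

text \<open>
  The \<open>4 n\<close> paths of the crown quiver come in four families indexed by \<open>1, \<dots>, n\<close>, and the four
  families are matched with the four entries of a matrix in \<open>\<Lambda>\<^sub>n\<close>.
\<close>

datatype crown_part = Source_Part | Sink_Part | Straight_Part | Skew_Part

lemma UNIV_crown_part: "UNIV = {Source_Part, Sink_Part, Straight_Part, Skew_Part}"
  using crown_part.exhaust by auto

instance crown_part :: finite
  by standard (simp add: UNIV_crown_part)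

fun crown_path :: "nat \<Rightarrow> crown_part \<Rightarrow> nat \<Rightarrow> crown_vertex \<times> crown_arrow list \<times> crown_vertex"
  where
    "crown_path n Source_Part i = (Source i, [], Source i)"
  | "crown_path n Sink_Part i = (Sink i, [], Sink i)"
  | "crown_path n Straight_Part i = (Source i, [Straight i], Sink i)"
  | "crown_path n Skew_Part i = (Source (if i = 1 then n else i - 1), [Skew i], Sink i)"

fun path_part :: "crown_vertex \<times> crown_arrow list \<times> crown_vertex \<Rightarrow> crown_part"
  where
    "path_part (Source _, [], _) = Source_Part"
  | "path_part (Sink _, [], _) = Sink_Part"
  | "path_part (_, Straight _ # _, _) = Straight_Part"
  | "path_part (_, Skew _ # _, _) = Skew_Part"

fun path_index :: "crown_vertex \<times> crown_arrow list \<times> crown_vertex \<Rightarrow> nat"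
  where
    "path_index (_, _, Source i) = i"
  | "path_index (_, _, Sink i) = i"

lemma path_part_crown_path [simp]: "path_part (crown_path n e i) = e"
  by (cases e) auto

lemma path_index_crown_path [simp]: "path_index (crown_path n e i) = i"
  by (cases e) auto

lemma crown_path_eq_iff [simp]: "crown_path n e i = crown_path n e' i' \<longleftrightarrow> e = e' \<and> i = i'"
  by (metis path_part_crown_path path_index_crown_path)

lemma crown_quiver_simps [simp]:
  "Source i \<in> verts (crown_quiver n) \<longleftrightarrow> i \<in> {1..n}"
  "Sink i \<in> verts (crown_quiver n) \<longleftrightarrow> i \<in> {1..n}"
  "Straight i \<in> arcs (crown_quiver n) \<longleftrightarrow> i \<in> {1..n}"
  "Skew i \<in> arcs (crown_quiver n) \<longleftrightarrow> i \<in> {1..n}"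
  "tail (crown_quiver n) (Straight i) = Source i"
  "tail (crown_quiver n) (Skew i) = Source (if i = 1 then n else i - 1)"
  "head (crown_quiver n) (Straight i) = Sink i"
  "head (crown_quiver n) (Skew i) = Sink i"
  by (auto simp: crown_quiver_def)

lemma tail_crown_quiver: "\<exists>i. tail (crown_quiver n) e = Source i"
  by (cases e) auto

lemma head_crown_quiver: "\<exists>i. head (crown_quiver n) e = Sink i"
  by (cases e) auto

lemma crown_path_in_quiver_paths:
  assumes "i \<in> {1..n}"
  shows "crown_path n e i \<in> quiver_paths (crown_quiver n)"
  using assms
  by (cases e) (auto simp: quiver_paths_def pre_digraph.awalk_def pre_digraph.cas.simps)

text \<open>
  No path has two arrows, because every arrow ends in a sink and starts in a source.
\<close>

lemma quiver_paths_crown: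
  "quiver_paths (crown_quiver n) = (\<Union>e. crown_path n e ` {1..n})"
proof (intro equalityI subsetI)
  fix w assume "w \<in> quiver_paths (crown_quiver n)"
  then obtain u p v where w: "w = (u, p, v)" and walk: "pre_digraph.awalk (crown_quiver n) u p v"
    by (auto simp: quiver_paths_def)
  have "\<exists>e i. i \<in> {1..n} \<and> w = crown_path n e i"
  proof (cases p)
    case Nil
    then have "u \<in> verts (crown_quiver n)" "u = v"
      using walk by (auto simp: pre_digraph.awalk_def pre_digraph.cas.simps)
    then obtain i where "i \<in> {1..n}" "u = Source i \<or> u = Sink i"
      by (cases u) auto
    then show ?thesis
      using \<open>u = v\<close> Nil w crown_path.simps(1,2)[of n i] by metis
  next
    case (Cons a q)
    have "q = []"
    proof (cases q)
      case (Cons b r)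
      then have "tail (crown_quiver n) b = head (crown_quiver n) a"
        using walk \<open>p = a # q\<close> by (simp add: pre_digraph.awalk_def pre_digraph.cas.simps)
      then show ?thesis
        using tail_crown_quiver[of n b] head_crown_quiver[of n a] by auto
    qed
    with Cons have "a \<in> arcs (crown_quiver n)"
      "u = tail (crown_quiver n) a" "v = head (crown_quiver n) a" and p: "p = [a]"
      using walk by (auto simp: pre_digraph.awalk_def pre_digraph.cas.simps)
    then obtain i where "i \<in> {1..n}" "w = crown_path n Straight_Part i \<or> w = crown_path n Skew_Part i"
      using w by (cases a) auto
    then show ?thesis by blast
  qed
  then show "w \<in> (\<Union>e. crown_path n e ` {1..n})"
    by blast
next
  fix w assume "w \<in> (\<Union>e. crown_path n e ` {1..n})"
  then obtain e i where "w = crown_path n e i" "i \<in> {1..n}"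
    by blast
  then show "w \<in> quiver_paths (crown_quiver n)"
    using crown_path_in_quiver_paths by blast
qed

lemma crown_path_cases:
  assumes "w \<in> quiver_paths (crown_quiver n)"
  obtains e i where "i \<in> {1..n}" "w = crown_path n e i"
  using assms unfolding quiver_paths_crown by blast

lemma finite_quiver_paths_crown: "finite (quiver_paths (crown_quiver n))"
  by (simp add: quiver_paths_crown)

lemma path_factorizations_outside:
  assumes "w \<notin> quiver_paths (crown_quiver n)"
  shows "path_factorizations (crown_quiver n) w = {}"
proof -
  have "(u, p @ q, v) \<in> quiver_paths Q"
    if "(u, p, x) \<in> quiver_paths Q" "(x, q, v) \<in> quiver_paths Q"
    for u p x q v and Q :: "('v, 'e) pre_digraph"
  proof -
    have "pre_digraph.cas Q u (p @ q) v"
      if "pre_digraph.cas Q u p x" "pre_digraph.cas Q x q v" for u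
      using that by (induction p arbitrary: u) (simp_all add: pre_digraph.cas.simps)
    then show ?thesis
      using that by (auto simp: quiver_paths_def pre_digraph.awalk_def)
  qed
  with assms show ?thesis
    by (fastforce simp: path_factorizations_def)
qed

lemma path_factorizations_crown:
  assumes i: "i \<in> {1..n}"
  shows "path_factorizations (crown_quiver n) (crown_path n Source_Part i) =
      {(crown_path n Source_Part i, crown_path n Source_Part i)}"
    and "path_factorizations (crown_quiver n) (crown_path n Sink_Part i) =
      {(crown_path n Sink_Part i, crown_path n Sink_Part i)}"
    and "path_factorizations (crown_quiver n) (crown_path n Straight_Part i) =
      {(crown_path n Source_Part i, crown_path n Straight_Part i),
       (crown_path n Straight_Part i, crown_path n Sink_Part i)}"
    and "path_factorizations (crown_quiver n) (crown_path n Skew_Part i) =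
      {(crown_path n Source_Part (if i = 1 then n else i - 1), crown_path n Skew_Part i),
       (crown_path n Skew_Part i, crown_path n Sink_Part i)}"
proof -
  have fact: "path_factorizations (crown_quiver n) (u, p, v) =
     {((u, q, x), (x, r, v)) | q r x. p = q @ r \<and>
        pre_digraph.awalk (crown_quiver n) u q x \<and> pre_digraph.awalk (crown_quiver n) x r v}" for u p v
    by (auto simp: path_factorizations_def quiver_paths_def)
  have split: "[a] = q @ r \<longleftrightarrow> q = [] \<and> r = [a] \<or> q = [a] \<and> r = []" for a and q r :: "'b list"
    by (cases q) auto
  have i': "(if i = 1 then n else i - 1) \<in> {1..n}"
    using i by auto
  show "path_factorizations (crown_quiver n) (crown_path n Source_Part i) =
      {(crown_path n Source_Part i, crown_path n Source_Part i)}"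
    "path_factorizations (crown_quiver n) (crown_path n Sink_Part i) =
      {(crown_path n Sink_Part i, crown_path n Sink_Part i)}"
    using i by (auto simp: fact pre_digraph.awalk_def pre_digraph.cas.simps)
  show "path_factorizations (crown_quiver n) (crown_path n Straight_Part i) =
      {(crown_path n Source_Part i, crown_path n Straight_Part i),
       (crown_path n Straight_Part i, crown_path n Sink_Part i)}"
    "path_factorizations (crown_quiver n) (crown_path n Skew_Part i) =
      {(crown_path n Source_Part (if i = 1 then n else i - 1), crown_path n Skew_Part i),
       (crown_path n Skew_Part i, crown_path n Sink_Part i)}"
    using i i' unfolding crown_path.simps fact split
    by (auto simp: pre_digraph.awalk_def pre_digraph.cas.simps simp del: One_nat_def)
qed


lemma path_algebra_simps [simp]:
  "carrier (path_algebra (root_field d) (crown_quiver n)) =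
     {f. \<forall>w. w \<notin> quiver_paths (crown_quiver n) \<longrightarrow> f w = 0}"
  "\<zero>\<^bsub>path_algebra (root_field d) Q\<^esub> = (\<lambda>_. 0)"
  "\<one>\<^bsub>path_algebra (root_field d) Q\<^esub> = (\<lambda>w. if \<exists>v\<in>verts Q. w = (v, [], v) then 1 else 0)"
  "f \<oplus>\<^bsub>path_algebra (root_field d) Q\<^esub> g = (\<lambda>w. f w + g w)"
  "c \<odot>\<^bsub>path_algebra (root_field d) Q\<^esub> f = (\<lambda>w. c * f w)"
proof -
  have "finite {w. f w \<noteq> 0}" if "\<forall>w. w \<notin> quiver_paths (crown_quiver n) \<longrightarrow> f w = 0"
    for f :: "_ \<Rightarrow> complex fls"
    by (rule finite_subset[OF _ finite_quiver_paths_crown[of n]]) (use that in auto)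
  then show "carrier (path_algebra (root_field d) (crown_quiver n)) =
     {f. \<forall>w. w \<notin> quiver_paths (crown_quiver n) \<longrightarrow> f w = 0}"
    by (auto simp: path_algebra_def)
qed (simp_all add: path_algebra_def cong: if_cong)

lemma path_algebra_mult_outside:
  assumes "w \<notin> quiver_paths (crown_quiver n)"
  shows "(f \<otimes>\<^bsub>path_algebra (root_field d) (crown_quiver n)\<^esub> g) w = 0"
  using assms by (simp add: path_algebra_def path_factorizations_outside finsum_root_field)

text \<open>
  A trivial path factors only through itself, and an arrow factors only by splitting off the trivial
  path at its source or at its target. The result has the shape of a product of triangular matrices,
  apart from the shifted index in the last case.
\<close>

lemma path_algebra_mult_crown_path:
  assumes "i \<in> {1..n}"
  shows "(f \<otimes>\<^bsub>path_algebra (root_field d) (crown_quiver n)\<^esub> g) (crown_path n e i) =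
    (let p = (\<lambda>e. crown_path n e i) in case e of
       Source_Part \<Rightarrow> f (p Source_Part) * g (p Source_Part)
     | Sink_Part \<Rightarrow> f (p Sink_Part) * g (p Sink_Part)
     | Straight_Part \<Rightarrow> f (p Source_Part) * g (p Straight_Part) + f (p Straight_Part) * g (p Sink_Part)
     | Skew_Part \<Rightarrow> f (crown_path n Source_Part (if i = 1 then n else i - 1)) * g (p Skew_Part)
                    + f (p Skew_Part) * g (p Sink_Part))"
proof -
  have "(f \<otimes>\<^bsub>path_algebra (root_field d) (crown_quiver n)\<^esub> g) (crown_path n e i) =
      (\<Sum>st\<in>path_factorizations (crown_quiver n) (crown_path n e i). f (fst st) * g (snd st))"
    using assms
    by (cases e)
       (simp_all add: path_algebra_def path_factorizations_crown finsum_root_field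
          del: crown_path.simps)
  then show ?thesis
    using assms by (cases e) (simp_all add: path_factorizations_crown del: crown_path.simps)
qed

lemma path_algebra_one_crown_path:
  assumes "i \<in> {1..n}"
  shows "\<one>\<^bsub>path_algebra (root_field d) (crown_quiver n)\<^esub> (crown_path n e i) =
    (if e = Source_Part \<or> e = Sink_Part then 1 else 0)"
  using assms by (cases e) auto


section \<open>The triangular matrix algebra\<close>

lemma Lambda_simps [simp]:
  "carrier (Lambda n) = UNIV"
  "\<one>\<^bsub>Lambda n\<^esub> = (1, (0, 0), 1)"
  "(a, (x, y), b) \<otimes>\<^bsub>Lambda n\<^esub> (a', (x', y'), b') =
     (a * a', (a * x' + x * b', sigma n a * y' + y * b'), b * b')"
  "l \<oplus>\<^bsub>Lambda n\<^esub> l' = l + l'"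
  "c \<odot>\<^bsub>Lambda n\<^esub> (a, (x, y), b) =
     (fls_compose_power c n * a,
      (fls_compose_power c n * x, sigma n (fls_compose_power c n) * y),
      fls_compose_power c n * b)"
  by (simp_all add: Lambda_def triangular_algebra_def Lambda_bimodule_def bimodule_sum_def
      left_twist_def regular_bimodule_def case_prod_unfold plus_prod_def)

fun matrix_part :: "'a \<times> ('a \<times> 'a) \<times> 'a \<Rightarrow> crown_part \<Rightarrow> 'a"
  where
    "matrix_part (a, (x, y), b) Source_Part = a"
  | "matrix_part (a, (x, y), b) Sink_Part = b"
  | "matrix_part (a, (x, y), b) Straight_Part = x"
  | "matrix_part (a, (x, y), b) Skew_Part = y"

fun matrix_unit :: "crown_part \<Rightarrow> 'a::zero \<Rightarrow> 'a \<times> ('a \<times> 'a) \<times> 'a"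
  where
    "matrix_unit Source_Part z = (z, (0, 0), 0)"
  | "matrix_unit Sink_Part z = (0, (0, 0), z)"
  | "matrix_unit Straight_Part z = (0, (z, 0), 0)"
  | "matrix_unit Skew_Part z = (0, (0, z), 0)"

lemma matrix_part_unit: "matrix_part (matrix_unit e z) e' = (if e = e' then z else 0)"
  by (cases e; cases e') auto

lemma matrix_part_add:
  fixes l l' :: "'a::plus \<times> ('a \<times> 'a) \<times> 'a"
  shows "matrix_part (l + l') e = matrix_part l e + matrix_part l' e"
  by (cases l; cases l'; cases e) auto

lemma matrix_unit_0 [simp]: "matrix_unit e 0 = 0"
  by (cases e) (simp_all add: zero_prod_def)

lemma matrix_unit_add: "matrix_unit e (x + y) = matrix_unit e x + matrix_unit e (y :: 'a::monoid_add)"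
  by (cases e) simp_all

lemma matrix_unit_sum:
  fixes f :: "'b \<Rightarrow> 'a::comm_monoid_add"
  shows "matrix_unit e (sum f J) = (\<Sum>j\<in>J. matrix_unit e (f j))"
  by (induction J rule: infinite_finite_induct) (simp_all add: matrix_unit_add)

lemma matrix_eq_sum_units:
  fixes l :: "'a::comm_monoid_add \<times> ('a \<times> 'a) \<times> 'a"
  shows "l = (\<Sum>e\<in>UNIV. matrix_unit e (matrix_part l e))"
  by (cases l) (auto simp: UNIV_crown_part)

lemma monoid_Lambda: "Group.monoid (Lambda n)"
proof (rule Group.monoidI)
  fix l l' l'' :: "complex fls \<times> (complex fls \<times> complex fls) \<times> complex fls"
  show "l \<otimes>\<^bsub>Lambda n\<^esub> l' \<otimes>\<^bsub>Lambda n\<^esub> l'' = l \<otimes>\<^bsub>Lambda n\<^esub> (l' \<otimes>\<^bsub>Lambda n\<^esub> l'')"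
    by (cases l; cases l'; cases l'') (auto simp: algebra_simps)
  show "\<one>\<^bsub>Lambda n\<^esub> \<otimes>\<^bsub>Lambda n\<^esub> l = l" "l \<otimes>\<^bsub>Lambda n\<^esub> \<one>\<^bsub>Lambda n\<^esub> = l"
    by (cases l; auto)+
qed simp_all

lemma matrix_part_smult:
  assumes "n > 0"
  shows "matrix_part (c \<odot>\<^bsub>Lambda n\<^esub> l) e = fls_compose_power c n * matrix_part l e"
  using assms by (cases l; cases e) (auto simp: sigma_fixes_base_field)

lemma smult_matrix_unit:
  assumes "n > 0"
  shows "c \<odot>\<^bsub>Lambda n\<^esub> matrix_unit e z = matrix_unit e (fls_compose_power c n * z)"
  using assms by (cases e) (auto simp: sigma_fixes_base_field)

lemma matrix_part_mult:
  "matrix_part (l \<otimes>\<^bsub>Lambda n\<^esub> l') Source_Part = matrix_part l Source_Part * matrix_part l' Source_Part"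
  "matrix_part (l \<otimes>\<^bsub>Lambda n\<^esub> l') Sink_Part = matrix_part l Sink_Part * matrix_part l' Sink_Part"
  "matrix_part (l \<otimes>\<^bsub>Lambda n\<^esub> l') Straight_Part =
     matrix_part l Source_Part * matrix_part l' Straight_Part
     + matrix_part l Straight_Part * matrix_part l' Sink_Part"
  "matrix_part (l \<otimes>\<^bsub>Lambda n\<^esub> l') Skew_Part =
     sigma n (matrix_part l Source_Part) * matrix_part l' Skew_Part
     + matrix_part l Skew_Part * matrix_part l' Sink_Part"
  by (cases l; cases l'; auto)+


section \<open>The isomorphism\<close>

text \<open>
  At the path of index \<open>i\<close> in a given family, \<open>s \<otimes> l\<close> is sent to \<open>s F\<^sub>i(z)\<close>, where \<open>z\<close> is
  the entry of \<open>l\<close> that belongs to the family. The index of an arrow is that of its target.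
\<close>

definition crown_coordinates ::
  "nat \<Rightarrow> nat \<Rightarrow> complex fls \<times> complex fls \<times> (complex fls \<times> complex fls) \<times> complex fls
    \<Rightarrow> crown_vertex \<times> crown_arrow list \<times> crown_vertex \<Rightarrow> complex fls"
  where "crown_coordinates n d p w =
    (if w \<in> quiver_paths (crown_quiver n)
     then fst p * galois_embedding n d (path_index w) (matrix_part (snd p) (path_part w)) else 0)"

definition crown_hom ::
  "nat \<Rightarrow> nat \<Rightarrow> (complex fls \<times> complex fls \<times> (complex fls \<times> complex fls) \<times> complex fls \<Rightarrow>\<^sub>0 int)
    \<Rightarrow> crown_vertex \<times> crown_arrow list \<times> crown_vertex \<Rightarrow> complex fls"
  where "crown_hom n d f = (\<lambda>w. frag_eval (\<lambda>p. crown_coordinates n d p w) f)"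

lemma crown_hom_linear:
  "crown_hom n d 0 w = 0"
  "crown_hom n d (f + g) w = crown_hom n d f w + crown_hom n d g w"
  "crown_hom n d (f - g) w = crown_hom n d f w - crown_hom n d g w"
  "crown_hom n d (sum F J) w = (\<Sum>j\<in>J. crown_hom n d (F j) w)"
  by (simp_all add: crown_hom_def frag_eval_add frag_eval_diff frag_eval_sum)

lemma crown_hom_outside:
  assumes "w \<notin> quiver_paths (crown_quiver n)"
  shows "crown_hom n d f w = 0"
  using assms by (simp add: crown_hom_def crown_coordinates_def frag_eval_def)

lemma crown_hom_frag_of:
  assumes "i \<in> {1..n}"
  shows "crown_hom n d (frag_of (s, l)) (crown_path n e i)
       = s * galois_embedding n d i (matrix_part l e)"
  using crown_path_in_quiver_paths[OF assms]
  by (simp add: crown_hom_def crown_coordinates_def)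

lemma crown_fun_eqI:
  assumes "\<And>w. w \<notin> quiver_paths (crown_quiver n) \<Longrightarrow> f w = g w"
    and "\<And>e i. i \<in> {1..n} \<Longrightarrow> f (crown_path n e i) = g (crown_path n e i)"
  shows "f = g"
proof
  fix w show "f w = g w"
    using assms crown_path_cases[of w n] by (cases "w \<in> quiver_paths (crown_quiver n)") metis+
qed

text \<open>
  By biadditivity it suffices to compare both sides on pure tensors. There the only case that is not
  immediate from the multiplicativity of the embeddings is that of a skew arrow, where
  \<open>galois_embedding_sigma\<close> turns the twist into the passage to the source of the arrow.
\<close>

lemma crown_hom_mult:
  assumes "n > 0" "d > 0" "n dvd d"
  shows "crown_hom n d (f \<otimes>\<^bsub>free_tensor_ring (root_field d) (Lambda n)\<^esub> g)
       = crown_hom n d f \<otimes>\<^bsub>path_algebra (root_field d) (crown_quiver n)\<^esub> crown_hom n d g"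
proof (rule crown_fun_eqI)
  fix w assume "w \<notin> quiver_paths (crown_quiver n)"
  then show "crown_hom n d (f \<otimes>\<^bsub>free_tensor_ring (root_field d) (Lambda n)\<^esub> g) w
     = (crown_hom n d f \<otimes>\<^bsub>path_algebra (root_field d) (crown_quiver n)\<^esub> crown_hom n d g) w"
    by (simp add: crown_hom_outside path_algebra_mult_outside)
next
  fix e i assume i: "i \<in> {1..n}"
  let ?F = "free_tensor_ring (root_field d) (Lambda n)"
  let ?P = "path_algebra (root_field d) (crown_quiver n)"
  let ?E = "\<lambda>f g. crown_hom n d (f \<otimes>\<^bsub>?F\<^esub> g) (crown_path n e i)
        = (crown_hom n d f \<otimes>\<^bsub>?P\<^esub> crown_hom n d g) (crown_path n e i)"
  define i' where "i' = (if i = 1 then n else i - 1)"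
  have i': "i' \<in> {1..n}"
    using i by (auto simp: i'_def)
  note mult = path_algebra_mult_crown_path[OF i, folded i'_def]
  note [simp del] = crown_path.simps
  have generators: "?E (frag_of (s, l)) (frag_of (s', l'))" for s l s' l'
    using galois_embedding_sigma[OF assms(1) i, of d, folded i'_def]
    by (cases e)
       (simp_all add: mult Let_def crown_hom_frag_of[OF i] crown_hom_frag_of[OF i'] matrix_part_mult
          galois_embedding_mult galois_embedding_add algebra_simps)
  have univ: "f \<in> carrier ?F" "g \<in> carrier ?F"
    by simp_all
  have generator_left: "?E (frag_of (s, l)) g" for s l
    using univ(2)
  proof (induction rule: free_tensor_induct)
    case (diff g g')
    then show ?case
      by (cases e) (simp_all add: free_tensor_mult_linear crown_hom_linear mult Let_def algebra_simps)
  next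
    case (pure s' l')
    show ?case by (rule generators)
  qed (simp add: free_tensor_mult_linear crown_hom_linear mult Let_def split: crown_part.split)
  show "?E f g"
    using univ(1)
  proof (induction rule: free_tensor_induct)
    case (diff f f')
    then show ?case
      by (cases e) (simp_all add: free_tensor_mult_linear crown_hom_linear mult Let_def algebra_simps)
  next
    case (pure s l)
    show ?case by (rule generator_left)
  qed (simp add: free_tensor_mult_linear crown_hom_linear mult Let_def split: crown_part.split)
qed

lemma crown_hom_one:
  assumes "n > 0" "d > 0" "n dvd d"
  shows "crown_hom n d (frag_of (1, (1, (0, 0), 1)))
       = \<one>\<^bsub>path_algebra (root_field d) (crown_quiver n)\<^esub>"
proof (rule crown_fun_eqI)
  fix w assume w: "w \<notin> quiver_paths (crown_quiver n)"
  then have "\<not> (\<exists>v\<in>verts (crown_quiver n). w = (v, [], v))"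
    by (auto simp: quiver_paths_def pre_digraph.awalk_def pre_digraph.cas.simps)
  with w show "crown_hom n d (frag_of (1, (1, (0, 0), 1))) w
       = \<one>\<^bsub>path_algebra (root_field d) (crown_quiver n)\<^esub> w"
    by (simp add: crown_hom_outside)
next
  fix e i assume i: "i \<in> {1..n}"
  then show "crown_hom n d (frag_of (1, (1, (0, 0), 1))) (crown_path n e i)
       = \<one>\<^bsub>path_algebra (root_field d) (crown_quiver n)\<^esub> (crown_path n e i)"
    unfolding path_algebra_one_crown_path[OF i] crown_hom_frag_of[OF i]
    using assms by (cases e) auto
qed

lemma crown_hom_balanced:
  assumes "n > 0" "d > 0" "n dvd d"
    and "x \<in> tensor_relations laurent_field (root_field d) (Lambda n)"
  shows "crown_hom n d x = (\<lambda>_. 0)"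
proof (rule crown_fun_eqI)
  fix e i assume i: "i \<in> {1..n}"
  from assms(4) show "crown_hom n d x (crown_path n e i) = 0"
    by (cases rule: tensor_relations_cases)
       (simp_all add: crown_hom_linear crown_hom_frag_of[OF i] matrix_part_add matrix_part_smult assms(1-3)
        galois_embedding_add galois_embedding_mult galois_embedding_base_field distrib_left distrib_right
          mult_ac del: crown_path.simps)
qed (simp add: crown_hom_outside)

text \<open>
  The inverse isomorphism on representatives. On each family of paths it expands a function
  of \<open>i\<close> in the basis \<open>(F\<^sub>i (t\<^sup>j))\<^sub>i\<close>, \<open>j < n\<close>, of \<open>k\<^sub>d\<^sup>n\<close>; the coefficients are found by pairing
  with the dual basis \<open>(F\<^sub>i (t\<^sup>-\<^sup>j) / n)\<^sub>i\<close>.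
\<close>

definition crown_section ::
  "nat \<Rightarrow> nat \<Rightarrow> (crown_vertex \<times> crown_arrow list \<times> crown_vertex \<Rightarrow> complex fls)
    \<Rightarrow> (complex fls \<times> complex fls \<times> (complex fls \<times> complex fls) \<times> complex fls \<Rightarrow>\<^sub>0 int)"
  where "crown_section n d f = (\<Sum>(e, j)\<in>UNIV \<times> {..<n}.
    frag_of (\<Sum>i=1..n. f (crown_path n e i)
               * (fls_const (1 / of_nat n) * galois_embedding n d i (fls_X_intpow (- int j))),
             matrix_unit e (fls_X_intpow (int j))))"

lemma crown_hom_section:
  assumes "n > 0" "d > 0" "n dvd d" "i \<in> {1..n}"
  shows "crown_hom n d (crown_section n d f) (crown_path n e i) = f (crown_path n e i)"
proof -
  let ?F = "galois_embedding n d" and ?X = "fls_X_intpow :: int \<Rightarrow> complex fls"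
  let ?c = "fls_const (1 / of_nat n) :: complex fls"
  let ?s = "\<lambda>e j. \<Sum>i'=1..n. f (crown_path n e i') * (?c * ?F i' (?X (- int j)))"
  have "crown_hom n d (crown_section n d f) (crown_path n e i)
      = (\<Sum>e'\<in>UNIV. \<Sum>j<n. ?s e' j * ?F i (matrix_part (matrix_unit e' (?X (int j))) e))"
    unfolding crown_section_def crown_hom_linear sum.cartesian_product
    by (intro sum.cong refl) (simp add: case_prod_unfold crown_hom_frag_of[OF assms(4)] del: crown_path.simps)
  also have "\<dots> = (\<Sum>e'\<in>UNIV. if e' = e then \<Sum>j<n. ?s e j * ?F i (?X (int j)) else 0)"
    by (intro sum.cong refl) (auto simp: matrix_part_unit)
  also have "\<dots> = (\<Sum>j<n. ?s e j * ?F i (?X (int j)))"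
    by simp
  also have "\<dots> = (\<Sum>i'=1..n. f (crown_path n e i') * (?c * (\<Sum>j<n. ?F i' (?X (- int j)) * ?F i (?X (int j)))))"
    unfolding sum_distrib_right sum_distrib_left by (subst sum.swap) (simp only: mult_ac)
  also have "\<dots> = (\<Sum>i'=1..n. if i' = i then f (crown_path n e i) else 0)"
    using assms by (intro sum.cong refl, subst galois_embedding_orthogonal) auto
  also have "\<dots> = f (crown_path n e i)"
    using assms by simp
  finally show ?thesis .
qed

lemma tensor_relations_subset: "tensor_relations laurent_field (root_field d) (Lambda n)
    \<subseteq> carrier (free_tensor_ring (root_field d) (Lambda n))"
  by auto

text \<open>
  On a pure tensor \<open>s \<otimes> l\<close> the trace formula turns the coefficients of the section into
  \<open>c s\<close>, where \<open>c\<close> runs over the coordinates of the entries of \<open>l\<close> over \<open>k\<close>. The relations move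
  \<open>c\<close> across the tensor sign, and the resulting second factors add up to \<open>l\<close>.
\<close>

lemma crown_section_hom:
  assumes n: "n > 0" "d > 0" "n dvd d"
  shows "crown_section n d (crown_hom n d x) - x
    \<in> tensor_ideal laurent_field (root_field d) (Lambda n)" (is "_ \<in> ?I")
proof -
  let ?u = "\<lambda>e j. matrix_unit e (fls_X_intpow (int j))
    :: complex fls \<times> (complex fls \<times> complex fls) \<times> complex fls"
  have I_zero: "0 \<in> ?I"
    by (rule tensor_ideal_zero)
  have I_diff: "x - y \<in> ?I" if "x \<in> ?I" "y \<in> ?I" for x y
    using tensor_relations_subset that by (rule tensor_ideal_diff)
  have I_sum: "sum f J \<in> ?I" if "\<And>j. j \<in> J \<Longrightarrow> f j \<in> ?I"
    for f :: "crown_part \<times> nat \<Rightarrow> _" and J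
    using that
  proof (induction J rule: infinite_finite_induct)
    case (insert j J)
    then show ?case
      using I_diff[of "f j" "0 - sum f J"] I_diff[of 0 "sum f J"] I_zero by simp
  qed (simp_all add: I_zero)
  have left: "frag_of (s + s', l) - frag_of (s, l) - frag_of (s', l) \<in> ?I" for s s' l
    using tensor_ideal_relations(1)[of s "root_field d" l "Lambda n" s'] by simp
  have right: "frag_of (s, l + l') - frag_of (s, l) - frag_of (s, l') \<in> ?I" for s l l'
    using tensor_ideal_relations(2)[of s "root_field d" l "Lambda n" l'] by simp
  have middle: "frag_of (fls_compose_power c d * s, l) - frag_of (s, c \<odot>\<^bsub>Lambda n\<^esub> l) \<in> ?I" for c s l
    using tensor_ideal_relations(3)[of s "root_field d" l "Lambda n" c laurent_field] by simp
  have section_diff: "crown_section n d f - crown_section n d (\<lambda>w. f w - g w) - crown_section n d g \<in> ?I"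
    for f g
  proof -
    let ?s = "\<lambda>f e j. \<Sum>i=1..n. f (crown_path n e i)
               * (fls_const (1 / of_nat n) * galois_embedding n d i (fls_X_intpow (- int j)))"
    have split: "?s f e j = ?s (\<lambda>w. f w - g w) e j + ?s g e j" for e j
      unfolding sum.distrib[symmetric] by (intro sum.cong refl) (simp only: left_diff_distrib diff_add_cancel)
    have "frag_of (?s f e j, ?u e j) - frag_of (?s (\<lambda>w. f w - g w) e j, ?u e j)
        - frag_of (?s g e j, ?u e j) \<in> ?I" for e j
      unfolding split[of e j] by (rule left)
    then show ?thesis
      unfolding crown_section_def sum_subtractf[symmetric] by (intro I_sum) (simp only: split_beta)
  qed
  have "x \<in> carrier (free_tensor_ring (root_field d) (Lambda n))"
    by simp
  then show ?thesis
  proof (induction rule: free_tensor_induct)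
    case zero
    have "crown_hom n d 0 = (\<lambda>_. 0)"
      by (rule ext) (rule crown_hom_linear)
    then show ?case
      using I_diff[OF I_zero section_diff[of "\<lambda>_. 0" "\<lambda>_. 0"]] by simp
  next
    case (diff f g)
    have hom_diff: "crown_hom n d (f - g) = (\<lambda>w. crown_hom n d f w - crown_hom n d g w)"
      by (rule ext) (rule crown_hom_linear)
    then have "crown_section n d (crown_hom n d (f - g)) - (f - g) =
        (crown_section n d (crown_hom n d f) - f) - (crown_section n d (crown_hom n d g) - g)
        - (crown_section n d (crown_hom n d f) - crown_section n d (crown_hom n d (f - g))
           - crown_section n d (crown_hom n d g))"
      by simp
    also have "\<dots> \<in> ?I"
      unfolding hom_diff by (intro I_diff diff section_diff)
    finally show ?case .
  next
    case (pure s l)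
    let ?c = "\<lambda>e j. fls_section n j (matrix_part l e)"
    let ?A = "\<Sum>(e, j)\<in>UNIV \<times> {..<n}. frag_of (fls_compose_power (?c e j) d * s, ?u e j)"
    let ?B = "\<Sum>(e, j)\<in>UNIV \<times> {..<n}. frag_of (s, ?c e j \<odot>\<^bsub>Lambda n\<^esub> ?u e j)"
    have "(\<Sum>i=1..n. crown_hom n d (frag_of (s, l)) (crown_path n e i)
               * (fls_const (1 / of_nat n) * galois_embedding n d i (fls_X_intpow (- int j))))
        = fls_compose_power (?c e j) d * s" for e j
    proof -
      have "(\<Sum>i=1..n. crown_hom n d (frag_of (s, l)) (crown_path n e i)
               * (fls_const (1 / of_nat n) * galois_embedding n d i (fls_X_intpow (- int j))))
          = s * fls_const (1 / of_nat n)
            * (\<Sum>i=1..n. galois_embedding n d i (matrix_part l e * fls_X_intpow (- int j)))"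
        unfolding sum_distrib_left
        by (intro sum.cong refl) (simp only: crown_hom_frag_of galois_embedding_mult mult_ac)
      also have "\<dots> = s * fls_compose_power (?c e j) d * (fls_const (1 / of_nat n) * fls_const (of_nat n))"
        unfolding sum_galois_embedding[OF n] by (simp only: mult_ac)
      also have "\<dots> = fls_compose_power (?c e j) d * s"
        using n by simp
      finally show ?thesis .
    qed
    then have "crown_section n d (crown_hom n d (frag_of (s, l))) = ?A"
      unfolding crown_section_def by simp
    moreover have "?A - ?B \<in> ?I"
      unfolding sum_subtractf[symmetric] by (intro I_sum) (simp only: split_beta middle)
    moreover have "frag_of (s, l) - ?B \<in> ?I"
    proof -
      have "(\<Sum>(e, j)\<in>UNIV \<times> {..<n}. ?c e j \<odot>\<^bsub>Lambda n\<^esub> ?u e j)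
          = (\<Sum>e\<in>UNIV. matrix_unit e (\<Sum>j<n. fls_compose_power (?c e j) n * fls_X_intpow (int j)))"
        unfolding smult_matrix_unit[OF n(1)] matrix_unit_sum sum.cartesian_product ..
      also have "\<dots> = l"
        unfolding fls_eq_sum_sections[OF n(1), symmetric] matrix_eq_sum_units[symmetric] ..
      finally have l: "(\<Sum>(e, j)\<in>UNIV \<times> {..<n}. ?c e j \<odot>\<^bsub>Lambda n\<^esub> ?u e j) = l" .
      show ?thesis
        using additive_modulo_sum[of ?I "\<lambda>l. frag_of (s, l)"
            "\<lambda>(e, j). ?c e j \<odot>\<^bsub>Lambda n\<^esub> ?u e j" "UNIV \<times> {..<n}", OF I_zero I_diff right]
        unfolding l by (simp add: case_prod_unfold)
    qed
    ultimately show ?case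
      using I_diff[of "?A - ?B" "frag_of (s, l) - ?B"] by simp
  qed
qed

theorem theorem3p2:
  fixes n d :: nat
  assumes "n > 0" and "d > 0" and "n dvd d"
  shows "algebra_isomorphic (root_field d)
           (base_change laurent_field (root_field d) (Lambda n))
           (path_algebra (root_field d) (crown_quiver n))"
proof (rule algebra_isomorphic_base_changeI)
  let ?F = "free_tensor_ring (root_field d) (Lambda n)"
  let ?P = "path_algebra (root_field d) (crown_quiver n)"
  let ?h = "crown_hom n d"
  show "Group.monoid (root_field d)" "Group.monoid (Lambda n)"
    by (rule monoid_root_field monoid_Lambda)+
  show "tensor_relations laurent_field (root_field d) (Lambda n) \<subseteq> carrier ?F"
    by (rule tensor_relations_subset)
  show "?h \<in> ring_hom ?F ?P"
    using crown_hom_mult[OF assms] crown_hom_one[OF assms]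
    by (intro ring_hom_memI) (auto simp: crown_hom_outside crown_hom_linear fun_eq_iff)
  show "?h 0 = \<zero>\<^bsub>?P\<^esub>"
    by (auto simp: crown_hom_linear)
  show "?h ` carrier ?F = carrier ?P"
  proof (intro equalityI subsetI)
    fix f assume "f \<in> carrier ?P"
    then have outside: "f w = 0" if "w \<notin> quiver_paths (crown_quiver n)" for w
      using that unfolding path_algebra_simps by blast
    have "?h (crown_section n d f) = f"
      using assms
      by (intro crown_fun_eqI[where n = n]) (simp_all add: outside crown_hom_outside crown_hom_section
        del: crown_path.simps)
    then show "f \<in> ?h ` carrier ?F"
      by (intro image_eqI[of _ _ "crown_section n d f"]) auto
  qed (auto simp: crown_hom_outside)
  show "?h x = \<zero>\<^bsub>?P\<^esub>" if "x \<in> tensor_relations laurent_field (root_field d) (Lambda n)" for x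
    using crown_hom_balanced[OF assms that] by simp
  show "crown_section n d (?h x) - x \<in> tensor_ideal laurent_field (root_field d) (Lambda n)" for x
    by (rule crown_section_hom) fact+
  show "?h (frag_of (s, \<one>\<^bsub>Lambda n\<^esub>)) \<otimes>\<^bsub>?P\<^esub> z = s \<odot>\<^bsub>?P\<^esub> z" if z: "z \<in> carrier ?P" for s z
  proof (rule crown_fun_eqI)
    fix w assume w: "w \<notin> quiver_paths (crown_quiver n)"
    then have "z w = 0"
      using z unfolding path_algebra_simps by blast
    with w show "(?h (frag_of (s, \<one>\<^bsub>Lambda n\<^esub>)) \<otimes>\<^bsub>?P\<^esub> z) w = (s \<odot>\<^bsub>?P\<^esub> z) w"
      by (simp add: path_algebra_mult_outside)
  next
    fix e i assume i: "i \<in> {1..n}"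
    then have "(if i = 1 then n else i - 1) \<in> {1..n}"
      by auto
    note hom = crown_hom_frag_of[OF this] crown_hom_frag_of[OF i]
    show "(?h (frag_of (s, \<one>\<^bsub>Lambda n\<^esub>)) \<otimes>\<^bsub>?P\<^esub> z) (crown_path n e i) = (s \<odot>\<^bsub>?P\<^esub> z) (crown_path n e i)"
      unfolding path_algebra_mult_crown_path[OF i] Let_def hom
      using assms by (cases e) (simp_all del: crown_path.simps)
  qed
qed

end
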